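(* Let $\alpha\in\mathbb{R}$, $0<p_0<p,q<\infty$ (that is, $0<p_0<p<\infty$ and $p_0<q<\infty$), $0<\lambda<\min\{\alpha+n/p,\alpha+m/p\}$, and $$\max\left\{-\frac np,-\frac mp\right\}<\alpha<\min\left\{n\left(\frac1{p_0}-\frac1p\right),m\left(\frac1{p_0}-\frac1p\right)\right\}.$$ Put $X=B\vec{\dot K}_{(p/p_0)',(q/p_0)'}^{-p_0\alpha,\,p_0\lambda}(\mathbb{R}^n\times\mathbb{R}^m)$. Let $\mathfrak{F}$ be a family of ordered pairs $(f,g)$ of measurable functions on $\mathbb{R}^n\times\mathbb{R}^m$. Suppose there is a constant $C>0$ such that for every $v\in\{\mathfrak{R}h:\|h\|_X\le1\}$ and every $(f,g)\in\mathfrak{F}$, $$\int_{\mathbb{R}^n\times\mathbb{R}^m}|f(x)|^{p_0}v(x)\,dx\le C\int_{\mathbb{R}^n\times\mathbb{R}^m}|g(x)|^{p_0}v(x)\,dx<\infty.$$ Then there is a constant $C'>0$ such that for every $(f,g)\in\mathfrak{F}$, $$\|f\|_{M\vec{\dot K}_{p,q}^{\alpha,\lambda}(\mathbb{R}^n\times\mathbb{R}^m)}\le C'\|g\|_{M\vec{\dot K}_{p,q}^{\alpha,\lambda}(\mathbb{R}^n\times\mathbb{R}^m)}.$$ Moreover, there is a constant $C''>0$ such that for all sequences $(f_i,g_i)\in\mathfrak{F}$, $i\in\mathbb{N}$, $$\left\|\Big(\sum_{i\in\mathbb{N}}|f_i|^{p_0}\Big)^{1/p_0}\right\|_{M\vec{\dot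 K}_{p,q}^{\alpha,\lambda}(\mathbb{R}^n\times\mathbb{R}^m)}\le C''\left\|\Big(\sum_{i\in\mathbb{N}}|g_i|^{p_0}\Big)^{1/p_0}\right\|_{M\vec{\dot K}_{p,q}^{\alpha,\lambda}(\mathbb{R}^n\times\mathbb{R}^m)}.$$
   Context: $n,m$ are positive integers; $r'$ is the conjugate exponent of $r$. For $x\in\mathbb{R}^d$, $r>0$, $Q(x,r)$ is the cube centered at $x$ with side length $r$; $\mathcal{R}$ is the set of all $Q(x,r)\times Q(y,s)$, $x\in\mathbb{R}^n$, $y\in\mathbb{R}^m$, $r,s>0$. The strong maximal operator is $M_Sf(z)=\sup_{z\in R\in\mathcal{R}}\frac1{|R|}\int_R|f(z')|\,dz'$. For $k\in\mathbb{Z}$, $Q_k=Q(0,2^k)$ (in $\mathbb{R}^n$ or $\mathbb{R}^m$); $R_{i,j}=Q_i\times Q_j$; $I_i=Q_i\setminus Q_{i-1}\subset\mathbb{R}^n$, $J_j=Q_j\setminus Q_{j-1}\subset\mathbb{R}^m$; $\chi_{i,j}$ is the characteristic function of $I_i\times J_j$. For $a\in\mathbb{R}$, $0<r,s<\infty$, $\mu>0$ and measurable $f$ (norms may be $+\infty$): $$\|f\|_{\vec{\dot K}_{r,s}^{a}}=\Big(\sum_{i,j\in\mathbb{Z}}2^{(i+j)sa}\|f\chi_{i,j}\|_{L^r(\mathbb{R}^n\times\mathbb{R}^m)}^s\Big)^{1/s},\qquad \|f\|_{M\vec{\dot K}_{r,s}^{a,\mu}}=\sup_{L_1,L_2\in\mathbb{Z}}2^{-(L_1+L_2)\mu}\|f\chi_{R_{L_1,L_2}}\|_{\vec{\dot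 K}_{r,s}^{a}}.$$ A measurable $b$ is a product Herz-block, $b\in b\vec{\dot K}_{r,s}^{a,\mu}$, if it is supported in some $R_{l_1,l_2}$, $l_1,l_2\in\mathbb{Z}$, and $\|b\|_{\vec{\dot K}_{r,s}^{a}}\le2^{-\mu(l_1+l_2)}$. The product block-Herz space $B\vec{\dot K}_{r,s}^{a,\mu}$ is the set of all $\sum_{k=1}^\infty\lambda_kb_k$ with $\sum_k|\lambda_k|<\infty$, $b_k\in b\vec{\dot K}_{r,s}^{a,\mu}$ (for $r,s\ge1$ such series converge absolutely a.e.), with norm the infimum of $\sum_k|\lambda_k|$ over all such representations. Under the stated assumptions on the parameters $M_S$ is bounded on $X$; $\|M_S\|_X$ is its operator norm. The Rubio de Francia operator on $X$ is $$\mathfrak{R}h=\sum_{k=0}^\infty\frac{M_S^k(|h|)}{2^k\|M_S\|_X^k},$$ where $M_S^0$ is the identity and $M_S^k$ is the $k$-th iterate of $M_S$. *)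

theory Defs
  imports "HOL-Analysis.Analysis"
begin

text \<open>
  Conventions. The space R^n x R^m is the type \<open>(real ^ 'n) \<times> (real ^ 'm)\<close> with Lebesgue measure.
  Measurable functions are complex-valued and Lebesgue measurable. Every norm below, except
  that of the block space, depends only on the modulus of its argument, so it is defined on
  nonnegative extended functions, and it is applied to a complex function \<open>f\<close> through \<open>modf f\<close>.
\<close>

type_synonym ('n, 'm) prodsp = "(real ^ 'n) \<times> (real ^ 'm)"

definition modf :: "('a \<Rightarrow> complex) \<Rightarrow> 'a \<Rightarrow> ennreal"
  where "modf f = (\<lambda>z. ennreal (norm (f z)))"

text \<open>Powers with real exponent in \<open>[0, \<infinity>]\<close>; only positive exponents \<open>a\<close> are meant, so \<open>\<infinity>\<close> is
  sent to \<open>\<infinity>\<close>.\<close>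

definition epowr :: "ennreal \<Rightarrow> real \<Rightarrow> ennreal"  (infixr "epowr" 80)
  where "x epowr a = (if x = top then top else ennreal (enn2real x powr a))"

definition conj_exp :: "real \<Rightarrow> real"
  where "conj_exp r = r / (r - 1)"

subsection \<open>Rectangles and the strong maximal operator\<close>

definition cube :: "real ^ 'd::finite \<Rightarrow> real \<Rightarrow> (real ^ 'd::finite) set"
  where "cube x r = {y. \<forall>i. \<bar>y $ i - x $ i\<bar> < r / 2}"

definition rectangles :: "('n::finite, 'm::finite) prodsp set set"
  where "rectangles = {cube x r \<times> cube y s | x y r s. 0 < r \<and> 0 < s}"

definition strong_maximal :: "(('n::finite, 'm::finite) prodsp \<Rightarrow> ennreal) \<Rightarrow> ('n::finite, 'm::finite) prodsp \<Rightarrow> ennreal"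
  where "strong_maximal F z =
    (SUP R \<in> {R \<in> rectangles. z \<in> R}.
       (\<integral>\<^sup>+ w \<in> R. F w \<partial>lebesgue) / emeasure lebesgue R)"

subsection \<open>Product Herz and Morrey-Herz norms\<close>

definition dyadic_cube :: "int \<Rightarrow> (real ^ 'd::finite) set"
  where "dyadic_cube k = cube 0 (2 powi k)"

definition dyadic_rect :: "int \<Rightarrow> int \<Rightarrow> ('n::finite, 'm::finite) prodsp set"
  where "dyadic_rect i j = dyadic_cube i \<times> dyadic_cube j"

definition shell :: "int \<Rightarrow> (real ^ 'd::finite) set"
  where "shell k = dyadic_cube k - dyadic_cube (k - 1)"

definition Lr_norm :: "real \<Rightarrow> (('n::finite, 'm::finite) prodsp \<Rightarrow> ennreal) \<Rightarrow> ennreal"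
  where "Lr_norm r F = (\<integral>\<^sup>+ z. F z epowr r \<partial>lebesgue) epowr (1 / r)"

definition herz_norm :: "real \<Rightarrow> real \<Rightarrow> real \<Rightarrow> (('n::finite, 'm::finite) prodsp \<Rightarrow> ennreal) \<Rightarrow> ennreal"
  where "herz_norm r s a F =
    (\<Sum>\<^sub>\<infinity>(i, j) \<in> UNIV. ennreal (2 powr (real_of_int (i + j) * s * a)) *
        (Lr_norm r (\<lambda>z. F z * indicator (shell i \<times> shell j) z) epowr s)) epowr (1 / s)"

definition morrey_herz_norm ::
    "real \<Rightarrow> real \<Rightarrow> real \<Rightarrow> real \<Rightarrow> (('n::finite, 'm::finite) prodsp \<Rightarrow> ennreal) \<Rightarrow> ennreal"
  where "morrey_herz_norm r s a \<mu> F =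
    (SUP L1 :: int. SUP L2 :: int. ennreal (2 powr (- real_of_int (L1 + L2) * \<mu>)) *
        herz_norm r s a (\<lambda>z. F z * indicator (dyadic_rect L1 L2) z))"

subsection \<open>The product block-Herz space\<close>

definition herz_block ::
    "real \<Rightarrow> real \<Rightarrow> real \<Rightarrow> real \<Rightarrow> (('n::finite, 'm::finite) prodsp \<Rightarrow> complex) \<Rightarrow> bool"
  where "herz_block r s a \<mu> b \<longleftrightarrow>
    b \<in> borel_measurable lebesgue \<and>
    (\<exists>l1 l2 :: int. (\<forall>z. z \<notin> dyadic_rect l1 l2 \<longrightarrow> b z = 0) \<and>
       herz_norm r s a (modf b) \<le> ennreal (2 powr (- \<mu> * real_of_int (l1 + l2))))"

definition block_rep ::
    "real \<Rightarrow> real \<Rightarrow> real \<Rightarrow> real \<Rightarrow> (('n::finite, 'm::finite) prodsp \<Rightarrow> complex) \<Rightarrow>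
     (nat \<Rightarrow> complex) \<Rightarrow> (nat \<Rightarrow> ('n::finite, 'm::finite) prodsp \<Rightarrow> complex) \<Rightarrow> bool"
  where "block_rep r s a \<mu> h c b \<longleftrightarrow>
    summable (\<lambda>k. norm (c k)) \<and>
    (\<forall>k. herz_block r s a \<mu> (b k)) \<and>
    (AE z in lebesgue. (\<lambda>k. c k * b k z) sums h z)"

text \<open>The infimum of the empty set is \<open>\<infinity>\<close>, so the space consists of the functions of finite norm.\<close>

definition block_herz_norm ::
    "real \<Rightarrow> real \<Rightarrow> real \<Rightarrow> real \<Rightarrow> (('n::finite, 'm::finite) prodsp \<Rightarrow> complex) \<Rightarrow> ennreal"
  where "block_herz_norm r s a \<mu> h =
    Inf {ennreal (\<Sum>k. norm (c k)) | c b. block_rep r s a \<mu> h c b}"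

text \<open>Since \<open>strong_maximal\<close> is \<open>[0, \<infinity>]\<close>-valued, the norm is extended to such functions: one that is
  finite almost everywhere is identified with a complex function, any other is outside the
  space.\<close>

definition block_herz_enorm ::
    "real \<Rightarrow> real \<Rightarrow> real \<Rightarrow> real \<Rightarrow> (('n::finite, 'm::finite) prodsp \<Rightarrow> ennreal) \<Rightarrow> ennreal"
  where "block_herz_enorm r s a \<mu> G =
    (if AE z in lebesgue. G z < top
     then block_herz_norm r s a \<mu> (\<lambda>z. complex_of_real (enn2real (G z))) else top)"

subsection \<open>The Rubio de Francia operator on the block space\<close>

definition strong_maximal_opnorm ::
    "('n::finite) itself \<Rightarrow> ('m::finite) itself \<Rightarrow> real \<Rightarrow> real \<Rightarrow> real \<Rightarrow> real \<Rightarrow> ennreal"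
  where "strong_maximal_opnorm TN TM r s a \<mu> =
    (SUP h \<in> {h :: ('n::finite, 'm::finite) prodsp \<Rightarrow> complex. block_herz_norm r s a \<mu> h \<le> 1}.
       block_herz_enorm r s a \<mu> (strong_maximal (modf h)))"

definition rubio_de_francia ::
    "real \<Rightarrow> real \<Rightarrow> real \<Rightarrow> real \<Rightarrow> (('n::finite, 'm::finite) prodsp \<Rightarrow> complex) \<Rightarrow>
     ('n::finite, 'm::finite) prodsp \<Rightarrow> ennreal"
  where "rubio_de_francia r s a \<mu> h z =
    (\<Sum>k. (strong_maximal ^^ k) (modf h) z /
         (2 ^ k * strong_maximal_opnorm TYPE('n) TYPE('m) r s a \<mu> ^ k))"

end

theory Submission
  imports Defs
begin

text \<open>
  With \<open>r = p / p\<^sub>0\<close> and \<open>s = q / p\<^sub>0\<close>, the Morrey-Herz norm of \<open>F\<^sup>1\<^sup>/\<^sup>p\<^sup>0\<close> is a power of the norm of \<open>F\<close> with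
  exponents \<open>r, s > 1\<close>, and the latter is the supremum of \<open>\<integral> F \<bar>b\<bar>\<close> over the blocks \<open>b\<close> with conjugate
  exponents. For a block \<open>b\<close>, \<open>\<bar>b\<bar>\<close> is at most its Rubio de Francia majorant \<open>Rb\<close>, so the hypothesis bounds
  \<open>\<integral> F \<bar>b\<bar>\<close> by \<open>C \<integral> G Rb\<close>. By the Hoelder inequality between the Morrey-Herz and the block space, this is at most
  \<open>2 C\<close> times the norm of \<open>G\<close>, since the \<open>k\<close>-th term of \<open>Rb\<close> has block norm at most \<open>2\<^sup>-\<^sup>k\<close>.
\<close>

subsection \<open>Powers and the Hoelder inequality in \<open>[0, \<infinity>]\<close>\<close>

lemma epowr_top [simp]: "top epowr a = top"
  by (simp add: epowr_def)

lemma epowr_ennreal: "0 \<le> x \<Longrightarrow> ennreal x epowr a = ennreal (x powr a)"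
  by (simp add: epowr_def)

lemma epowr_0 [simp]: "0 epowr a = 0"
  by (simp add: epowr_def)

lemma epowr_1 [simp]: "x epowr 1 = x"
  by (cases x) (simp_all add: epowr_ennreal)

lemma epowr_eq_0_iff [simp]: "x epowr a = 0 \<longleftrightarrow> x = 0"
  by (cases x) (auto simp: epowr_ennreal)

lemma epowr_epowr: "(x epowr a) epowr b = x epowr (a * b)"
  by (cases x) (simp_all add: epowr_ennreal powr_powr)

lemma epowr_mult: "(x * y) epowr a = x epowr a * y epowr a"
proof (cases x; cases y)
  fix u v :: real assume "0 \<le> u" "x = ennreal u" "0 \<le> v" "y = ennreal v"
  then show ?thesis by (simp add: epowr_ennreal powr_mult flip: ennreal_mult)
qed (auto simp: ennreal_top_mult ennreal_mult_top epowr_ennreal)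

lemma epowr_mono: "0 < a \<Longrightarrow> x \<le> y \<Longrightarrow> x epowr a \<le> y epowr a"
  by (cases x; cases y) (auto simp: epowr_ennreal top_unique intro!: ennreal_leI powr_mono2)

lemma epowr_epowr_inverse [simp]:
  "a \<noteq> 0 \<Longrightarrow> (x epowr a) epowr (1 / a) = x" "a \<noteq> 0 \<Longrightarrow> (x epowr (1 / a)) epowr a = x"
  by (simp_all add: epowr_epowr)

lemma epowr_le_iff: "0 < a \<Longrightarrow> x epowr a \<le> y \<longleftrightarrow> x \<le> y epowr (1 / a)"
  using epowr_mono[of "1 / a" "x epowr a" y] epowr_mono[of a x "y epowr (1 / a)"] by auto

text \<open>For \<open>0 < a\<close> the power is an order automorphism of [0, \<infinity>] adjoint
  to the power \<open>1 / a\<close>, so it preserves every supremum.\<close>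

lemma SUP_epowr: "0 < a \<Longrightarrow> (SUP i\<in>I. f i) epowr a = (SUP i\<in>I. f i epowr a)"
proof (intro antisym)
  assume a: "0 < a"
  show "(SUP i\<in>I. f i) epowr a \<le> (SUP i\<in>I. f i epowr a)"
    using a unfolding epowr_le_iff[OF a] by (intro SUP_least) (simp add: SUP_upper[where f = "\<lambda>i. f i epowr a"] flip: epowr_le_iff)
  show "(SUP i\<in>I. f i epowr a) \<le> (SUP i\<in>I. f i) epowr a"
    using a by (intro SUP_least epowr_mono SUP_upper)
qed

lemma measurable_epowr [measurable]:
  "f \<in> borel_measurable M \<Longrightarrow> (\<lambda>x. f x epowr a) \<in> borel_measurable M"
  unfolding epowr_def by simp

lemma Young_ennreal:
  fixes x y :: ennreal
  assumes "1 < p" "1 < q" "1 / p + 1 / q = 1"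
  shows "x * y \<le> x epowr p / ennreal p + y epowr q / ennreal q"
proof (cases x; cases y)
  fix u v :: real assume "0 \<le> u" "x = ennreal u" "0 \<le> v" "y = ennreal v"
  then show ?thesis 
    using Youngs_inequality[OF assms, of u v] assms
    by (simp add: epowr_ennreal divide_ennreal flip: ennreal_mult ennreal_plus)
qed (use assms in \<open>auto simp: ennreal_top_divide\<close>)

text \<open>Dividing both functions by their norms makes each norm one; integrating Young's
  inequality then gives exactly \<open>1 / p + 1 / q = 1\<close>, and multiplying back by
  \<open>X * Y\<close> restores the functions. Zero and infinite norms are split off first.\<close>

lemma Holder_nn_integral:
  fixes f g :: "'a \<Rightarrow> ennreal"
  assumes [measurable]: "f \<in> borel_measurable M" "g \<in> borel_measurable M"
    and pq: "1 < p" "1 < q" "1 / p + 1 / q = 1"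
  shows "(\<integral>\<^sup>+x. f x * g x \<partial>M)
    \<le> (\<integral>\<^sup>+x. f x epowr p \<partial>M) epowr (1 / p) * (\<integral>\<^sup>+x. g x epowr q \<partial>M) epowr (1 / q)"
proof -
  define X Y where "X = (\<integral>\<^sup>+x. f x epowr p \<partial>M) epowr (1 / p)"
    and "Y = (\<integral>\<^sup>+x. g x epowr q \<partial>M) epowr (1 / q)"
  \<comment> \<open>Since \<open>0 * top = 0\<close>, a vanishing norm must be treated before an
    infinite one: it forces the integrand to vanish almost everywhere. Once both norms are nonzero,
    an infinite one makes the bound trivial.\<close>
  consider "X = 0" | "Y = 0" | "X \<noteq> 0" "Y \<noteq> 0" "X = top \<or> Y = top"
    | "X \<noteq> 0" "Y \<noteq> 0" "X \<noteq> top" "Y \<noteq> top" by blast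
  then have "(\<integral>\<^sup>+x. f x * g x \<partial>M) \<le> X * Y"
  proof cases
    case 1
    then have "AE x in M. f x = 0" by (simp add: X_def nn_integral_0_iff_AE)
    then have "(\<integral>\<^sup>+x. f x * g x \<partial>M) = 0" by (subst nn_integral_0_iff_AE) auto
    then show ?thesis by simp
  next
    case 2
    then have "AE x in M. g x = 0" by (simp add: Y_def nn_integral_0_iff_AE)
    then have "(\<integral>\<^sup>+x. f x * g x \<partial>M) = 0" by (subst nn_integral_0_iff_AE) auto
    then show ?thesis by simp
  next
    case 3
    then show ?thesis by (auto simp: ennreal_top_mult ennreal_mult_top)
  next
    case 4
    obtain u where u: "X = ennreal u" "0 < u"
      using 4 by (cases X) auto
    obtain v where v: "Y = ennreal v" "0 < v"
      using 4 by (cases Y) auto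
    have Xp: "(\<integral>\<^sup>+x. f x epowr p \<partial>M) = ennreal (u powr p)"
    proof -
      have "(\<integral>\<^sup>+x. f x epowr p \<partial>M) = X epowr p" using pq by (simp add: X_def)
      then show ?thesis using u by (simp add: epowr_ennreal)
    qed
    have Yq: "(\<integral>\<^sup>+x. g x epowr q \<partial>M) = ennreal (v powr q)"
    proof -
      have "(\<integral>\<^sup>+x. g x epowr q \<partial>M) = Y epowr q" using pq by (simp add: Y_def)
      then show ?thesis using v by (simp add: epowr_ennreal)
    qed
    define F G where "F = (\<lambda>x. ennreal (1 / u) * f x)" and "G = (\<lambda>x. ennreal (1 / v) * g x)"
    have [measurable]: "F \<in> borel_measurable M" "G \<in> borel_measurable M"
      by (simp_all add: F_def G_def)
    have F1: "(\<integral>\<^sup>+x. F x epowr p \<partial>M) = 1"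
      using u Xp by (simp add: F_def epowr_mult nn_integral_cmult epowr_ennreal powr_divide
          flip: ennreal_mult)
    have G1: "(\<integral>\<^sup>+x. G x epowr q \<partial>M) = 1"
      using v Yq by (simp add: G_def epowr_mult nn_integral_cmult epowr_ennreal powr_divide
          flip: ennreal_mult)
    have "(\<integral>\<^sup>+x. F x * G x \<partial>M) \<le> (\<integral>\<^sup>+x. F x epowr p / ennreal p + G x epowr q / ennreal q \<partial>M)"
      by (intro nn_integral_mono Young_ennreal pq)
    also have "\<dots> = 1 / ennreal p + 1 / ennreal q"
      by (simp add: nn_integral_add nn_integral_divide F1 G1)
    also have "\<dots> = 1"
      using pq by (simp add: divide_ennreal flip: ennreal_1 ennreal_plus)
    finally have "X * Y * (\<integral>\<^sup>+x. F x * G x \<partial>M) \<le> X * Y"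
      by (metis mult.right_neutral mult_left_mono zero_le)
    moreover have "X * Y * (\<integral>\<^sup>+x. F x * G x \<partial>M) = (\<integral>\<^sup>+x. (X * Y) * (F x * G x) \<partial>M)"
      by (simp add: nn_integral_cmult)
    moreover have "(X * Y) * (F x * G x) = f x * g x" for x
    proof -
      have "(X * Y) * (F x * G x) = (X * ennreal (1 / u)) * (Y * ennreal (1 / v)) * (f x * g x)"
        by (simp add: F_def G_def mult_ac)
      then show ?thesis using u v by (simp flip: ennreal_mult)
    qed
    ultimately show ?thesis by simp
  qed
  then show ?thesis by (simp add: X_def Y_def)
qed

text \<open>Turns the unordered sum over pairs (i, j) in the Herz norm into an integral for the
  counting measure, so that the Hoelder inequality and interchange of integrals apply to it. Both
  sides are transported to the natural numbers by \<open>to_nat\<close>, where they are ordinary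
  series.\<close>

lemma nn_integral_count_space_eq_infsum:
  fixes f :: "'a::countable \<Rightarrow> ennreal"
  shows "(\<integral>\<^sup>+x. f x \<partial>count_space UNIV) = (\<Sum>\<^sub>\<infinity>x. f x)"
proof -
  have nat: "(\<integral>\<^sup>+n. g n \<partial>count_space UNIV) = (\<Sum>\<^sub>\<infinity>n. g n)" for g :: "nat \<Rightarrow> ennreal"
    unfolding nn_integral_count_space_nat
  proof -
    have "g summable_on UNIV" by (rule nonneg_summable_on_complete) simp
    from has_sum_imp_sums[OF has_sum_infsum[OF this]] show "(\<Sum>n. g n) = (\<Sum>\<^sub>\<infinity>n. g n)"
      by (simp add: sums_iff)
  qed
  \<comment> \<open>\<open>to_nat\<close> need not be onto, so the transported function is extended
    by zero off its range.\<close>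
  let ?h = "\<lambda>n. f (from_nat n) * indicator (range (to_nat :: 'a \<Rightarrow> nat)) n"
  have bij: "bij_betw (to_nat :: 'a \<Rightarrow> nat) UNIV (range (to_nat :: 'a \<Rightarrow> nat))"
    by (simp add: bij_betw_def)
  have "(\<integral>\<^sup>+x. f x \<partial>count_space UNIV) = (\<integral>\<^sup>+x. f (from_nat (to_nat x)) \<partial>count_space (UNIV :: 'a set))"
    by simp
  also have "\<dots> = (\<integral>\<^sup>+n. f (from_nat n) \<partial>count_space (range (to_nat :: 'a \<Rightarrow> nat)))"
    by (rule nn_integral_bij_count_space[OF bij])
  also have "\<dots> = (\<integral>\<^sup>+n. ?h n \<partial>count_space UNIV)"
    by (simp add: nn_integral_count_space_indicator)
  also have "\<dots> = (\<Sum>\<^sub>\<infinity>n. ?h n)" by (rule nat)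
  also have "\<dots> = (\<Sum>\<^sub>\<infinity>n\<in>range (to_nat :: 'a \<Rightarrow> nat). f (from_nat n))"
    by (intro infsum_cong_neutral) (auto simp: indicator_def)
  also have "\<dots> = (\<Sum>\<^sub>\<infinity>x :: 'a. f (from_nat (to_nat x)))"
    by (rule infsum_reindex_bij_betw[OF bij, symmetric])
  finally show ?thesis by simp
qed

lemma herz_norm_eq_nn_integral:
  "herz_norm r s a F = (\<integral>\<^sup>+ij. ennreal (2 powr (real_of_int (fst ij + snd ij) * s * a)) *
     (Lr_norm r (\<lambda>z. F z * indicator (shell (fst ij) \<times> shell (snd ij)) z) epowr s) \<partial>count_space UNIV) epowr (1 / s)"
  by (simp add: herz_norm_def nn_integral_count_space_eq_infsum case_prod_unfold)

subsection \<open>Hoelder inequality for Morrey-Herz and block-Herz norms\<close>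

lemma conj_exp:
  assumes "1 < r"
  shows "1 < conj_exp r" "1 / r + 1 / conj_exp r = 1"
  using assms by (simp_all add: conj_exp_def field_simps)

section \<open>Dyadic cubes and the covering by products of shells\<close>

lemma cube_eq_box: "cube x r = box (\<chi> i. x $ i - r / 2) (\<chi> i. x $ i + r / 2)"
proof -
  have "\<bar>y $ i - x $ i\<bar> < r / 2 \<longleftrightarrow> x $ i - r / 2 < y $ i \<and> y $ i < x $ i + r / 2" for y i
    unfolding abs_less_iff by linarith
  then show ?thesis by (simp add: set_eq_iff cube_def mem_box_cart)
qed

lemma open_cube [simp]: "open (cube x r)" and bounded_cube [simp]: "bounded (cube x r)"
  by (simp_all add: cube_eq_box open_box)

text \<open>The side length is \<open>2 powi k\<close>, so coordinates are bounded by half of it;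
  hence the exponent \<open>k - 1\<close>.\<close>

lemma mem_dyadic_cube: "x \<in> dyadic_cube k \<longleftrightarrow> (\<forall>i. \<bar>x $ i\<bar> < 2 powr (real_of_int k - 1))"
  by (simp add: dyadic_cube_def cube_def powr_diff flip: powr_real_of_int')

lemma dyadic_cube_mono: "k \<le> l \<Longrightarrow> dyadic_cube k \<subseteq> dyadic_cube l"
  by (force simp: mem_dyadic_cube intro: less_le_trans)

text \<open>If i < j, the cube of index i lies in the cube of index j - 1, which is removed from the
  shell of index j.\<close>

lemma shell_disjoint:
  assumes "x \<in> shell k" "x \<in> shell l"
  shows "k = l"
proof -
  have "\<not> i < j" if "x \<in> shell i" "x \<in> shell j" for i j
    using that dyadic_cube_mono[of i "j - 1"] unfolding shell_def by force
  from this[OF assms] this[OF assms(2,1)] show ?thesis by simp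
qed

lemma ex_shell:
  assumes "x \<noteq> 0"
  shows "\<exists>k. x \<in> shell k"
proof -
  define M where "M = (MAX i. \<bar>x $ i\<bar>)"
  have M: "\<bar>x $ i\<bar> \<le> M" for i by (auto simp: M_def)
  have "M \<in> range (\<lambda>i. \<bar>x $ i\<bar>)" unfolding M_def by (intro Max_in) auto
  then obtain i where i: "M = \<bar>x $ i\<bar>" by auto
  obtain j where "x $ j \<noteq> 0" using assms by (auto simp: vec_eq_iff)
  then have "0 < M" using M[of j] by auto
  \<comment> \<open>A point with largest coordinate modulus \<open>M\<close> is in the shell of
    index k exactly if 2^(k-2) \<le> M < 2^(k-1), which forces this value.\<close>
  define k where "k = \<lfloor>log 2 M\<rfloor> + 2"
  have k: "real_of_int k - 2 \<le> log 2 M" "log 2 M < real_of_int k - 1"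
    by (auto simp: k_def) linarith
  then have "2 powr (real_of_int k - 2) \<le> M" "M < 2 powr (real_of_int k - 1)"
    using \<open>0 < M\<close> by (simp_all add: le_log_iff log_less_iff)
  then have "x \<in> dyadic_cube k" "\<not> \<bar>x $ i\<bar> < 2 powr (real_of_int (k - 1) - 1)"
    using le_less_trans[OF M] by (simp_all add: mem_dyadic_cube i)
  then have "x \<in> shell k"
    unfolding shell_def mem_dyadic_cube Diff_iff by blast
  then show ?thesis ..
qed

lemma dyadic_cube_borel [measurable]: "dyadic_cube k \<in> sets borel"
  by (simp add: dyadic_cube_def)

lemma dyadic_rect_borel [measurable]: "dyadic_rect k l \<in> sets borel"
  unfolding dyadic_rect_def by (intro borel_Times) measurable

lemma dyadic_rect_lebesgue [measurable]: "dyadic_rect k l \<in> sets lebesgue"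
  by (intro sets_completionI_sets) measurable

lemma shell_Times_lebesgue [measurable]: "shell k \<times> shell l \<in> sets lebesgue"
proof (intro sets_completionI_sets)
  have "shell k \<times> shell l \<in> sets borel"
    unfolding shell_def by (intro borel_Times sets.Diff dyadic_cube_borel)
  then show "shell k \<times> shell l \<in> sets lborel" by simp
qed

text \<open>The origin of each factor lies in no shell, so products of shells miss the two
  coordinate subspaces. Each of these lies in a hyperplane where one coordinate vanishes, hence is
  null.\<close>

lemma AE_off_axes:
  "AE z :: ('n::finite, 'm::finite) prodsp in lebesgue. fst z \<noteq> 0 \<and> snd z \<noteq> 0"
proof -
  have 1: "negligible {z :: ('n, 'm) prodsp. (axis undefined 1, 0) \<bullet> z = 0}"
    and 2: "negligible {z :: ('n, 'm) prodsp. (0, axis undefined 1) \<bullet> z = 0}"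
    by (rule negligible_hyperplane; simp add: prod_eq_iff axis_eq_0_iff)+
  have "AE z :: ('n, 'm) prodsp in lebesgue. (axis undefined 1, 0) \<bullet> z \<noteq> 0"
    using AE_not_in[of "{z :: ('n, 'm) prodsp. (axis undefined 1, 0) \<bullet> z = 0}" lebesgue] 1
    by (simp add: negligible_iff_null_sets)
  moreover have "AE z :: ('n, 'm) prodsp in lebesgue. (0, axis undefined 1) \<bullet> z \<noteq> 0"
    using AE_not_in[of "{z :: ('n, 'm) prodsp. (0, axis undefined 1) \<bullet> z = 0}" lebesgue] 2
    by (simp add: negligible_iff_null_sets)
  ultimately show ?thesis by eventually_elim auto
qed

text \<open>Almost every point lies in a product of shells, where \<open>F\<close> equals one of the
  summands; the countable sum is then exchanged with the integral.\<close>

lemma nn_integral_le_shells: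
  fixes F :: "('n::finite, 'm::finite) prodsp \<Rightarrow> ennreal"
  assumes [measurable]: "F \<in> borel_measurable lebesgue"
  shows "(\<integral>\<^sup>+z. F z \<partial>lebesgue)
    \<le> (\<integral>\<^sup>+ij. (\<integral>\<^sup>+z. F z * indicator (shell (fst ij) \<times> shell (snd ij)) z \<partial>lebesgue) \<partial>count_space UNIV)"
proof -
  let ?S = "\<lambda>ij z. F z * indicator (shell (fst ij) \<times> shell (snd ij)) z"
  have "(\<integral>\<^sup>+z. F z \<partial>lebesgue) \<le> (\<integral>\<^sup>+z. (\<integral>\<^sup>+ij. ?S ij z \<partial>count_space UNIV) \<partial>lebesgue)"
  proof (intro nn_integral_mono_AE, use AE_off_axes in eventually_elim)
    case (elim z)
    then obtain i j where "fst z \<in> shell i" "snd z \<in> shell j"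
      using ex_shell by meson
    then have "F z = ?S (i, j) z"
      by (simp add: indicator_def mem_Times_iff)
    also have "\<dots> \<le> (\<integral>\<^sup>+ij. ?S ij z \<partial>count_space UNIV)"
      by (rule nn_integral_ge_point) simp
    finally show ?case .
  qed
  also have "\<dots> = (\<integral>\<^sup>+ij. (\<integral>\<^sup>+z. ?S ij z \<partial>lebesgue) \<partial>count_space UNIV)"
    by (intro nn_integral_count_space_nn_integral) auto
  finally show ?thesis .
qed

lemma ennreal_powr_cancel:
  assumes "v = - u"
  shows "ennreal (2 powr u) * ennreal (2 powr v) = 1"
proof -
  have "2 powr u * 2 powr v = 1" using assms by (simp add: powr_minus)
  then show ?thesis by (simp flip: ennreal_mult)
qed

text \<open>The Hoelder inequality is used twice: with exponents \<open>r\<close> and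
  \<open>conj_exp r\<close> on each product of shells, then with \<open>s\<close> and
  \<open>conj_exp s\<close> in the sum over (i, j). In between, the weights 2^((i+j)a) and
  2^(-(i+j)a), whose product is one, are distributed over the two factors.\<close>

lemma Holder_herz_norm:
  fixes F G :: "('n::finite, 'm::finite) prodsp \<Rightarrow> ennreal"
  assumes [measurable]: "F \<in> borel_measurable lebesgue" "G \<in> borel_measurable lebesgue"
    and r: "1 < r" and s: "1 < s"
  shows "(\<integral>\<^sup>+z. F z * G z \<partial>lebesgue)
    \<le> herz_norm r s a F * herz_norm (conj_exp r) (conj_exp s) (- a) G"
proof -
  let ?c = "\<lambda>ij t. ennreal (2 powr (real_of_int (fst ij + snd ij) * t))"
  let ?\<chi> = "\<lambda>ij. indicator (shell (fst ij) \<times> shell (snd ij)) :: ('n, 'm) prodsp \<Rightarrow> ennreal"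
  let ?f = "\<lambda>ij. ?c ij a * Lr_norm r (\<lambda>z. F z * ?\<chi> ij z)"
  let ?g = "\<lambda>ij. ?c ij (- a) * Lr_norm (conj_exp r) (\<lambda>z. G z * ?\<chi> ij z)"
  have cc: "?c ij a * ?c ij (- a) = 1" for ij
    by (rule ennreal_powr_cancel) simp
  have *: "?c ij t epowr u = ennreal (2 powr (real_of_int (fst ij + snd ij) * u * t))" for ij t u
    by (simp add: epowr_ennreal powr_powr mult_ac)
  have "(\<integral>\<^sup>+z. F z * G z \<partial>lebesgue)
      \<le> (\<integral>\<^sup>+ij. (\<integral>\<^sup>+z. F z * G z * ?\<chi> ij z \<partial>lebesgue) \<partial>count_space UNIV)"
    by (intro nn_integral_le_shells) simp
  also have "\<dots> \<le> (\<integral>\<^sup>+ij. ?f ij * ?g ij \<partial>count_space UNIV)"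
  proof (intro nn_integral_mono)
    fix ij :: "int \<times> int"
    have "(\<integral>\<^sup>+z. F z * G z * ?\<chi> ij z \<partial>lebesgue)
        = (\<integral>\<^sup>+z. (F z * ?\<chi> ij z) * (G z * ?\<chi> ij z) \<partial>lebesgue)"
      by (intro nn_integral_cong) (simp split: split_indicator)
    also have "\<dots> \<le> Lr_norm r (\<lambda>z. F z * ?\<chi> ij z) * Lr_norm (conj_exp r) (\<lambda>z. G z * ?\<chi> ij z)"
      unfolding Lr_norm_def using r conj_exp[OF r] by (intro Holder_nn_integral) auto
    also have "\<dots> = (?c ij a * ?c ij (- a)) * \<dots>" by (simp only: cc mult_1)
    also have "\<dots> = ?f ij * ?g ij" by (simp only: mult_ac)
    finally show "(\<integral>\<^sup>+z. F z * G z * ?\<chi> ij z \<partial>lebesgue) \<le> ?f ij * ?g ij" .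
  qed
  also have "\<dots> \<le> (\<integral>\<^sup>+ij. ?f ij epowr s \<partial>count_space UNIV) epowr (1 / s)
      * (\<integral>\<^sup>+ij. ?g ij epowr conj_exp s \<partial>count_space UNIV) epowr (1 / conj_exp s)"
    using s conj_exp[OF s] by (intro Holder_nn_integral) auto
  finally show ?thesis by (simp only: herz_norm_eq_nn_integral epowr_mult *)
qed

lemma herz_norm_le_morrey_herz_norm:
  "herz_norm r s a (\<lambda>z. F z * indicator (dyadic_rect k l) z)
    \<le> ennreal (2 powr (real_of_int (k + l) * \<mu>)) * morrey_herz_norm r s a \<mu> F"
proof -
  let ?H = "herz_norm r s a (\<lambda>z. F z * indicator (dyadic_rect k l) z)"
  have c: "ennreal (2 powr (real_of_int (k + l) * \<mu>)) * ennreal (2 powr (- real_of_int (k + l) * \<mu>)) = 1"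
    by (rule ennreal_powr_cancel) (simp add: algebra_simps)
  have "?H = ennreal (2 powr (real_of_int (k + l) * \<mu>)) * (ennreal (2 powr (- real_of_int (k + l) * \<mu>)) * ?H)"
    by (simp only: c mult_1 flip: mult.assoc)
  also have "\<dots> \<le> ennreal (2 powr (real_of_int (k + l) * \<mu>)) * morrey_herz_norm r s a \<mu> F"
    unfolding morrey_herz_norm_def by (intro mult_left_mono SUP_upper2[of k] SUP_upper2[of l]) auto
  finally show ?thesis .
qed

text \<open>\<open>G\<close> may be cut off to the rectangle supporting the block. The factor
  2^((k+l)\<mu>) that this costs in the Morrey-Herz norm cancels the size 2^(-\<mu>(k+l)) of the
  block.\<close>

lemma nn_integral_mult_herz_block_le:
  fixes G :: "('n::finite, 'm::finite) prodsp \<Rightarrow> ennreal"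
  assumes [measurable]: "G \<in> borel_measurable lebesgue" and rs: "1 < r" "1 < s"
    and b: "herz_block (conj_exp r) (conj_exp s) (- a) \<mu> b"
  shows "(\<integral>\<^sup>+z. G z * modf b z \<partial>lebesgue) \<le> morrey_herz_norm r s a \<mu> G"
proof -
  have [measurable]: "b \<in> borel_measurable lebesgue" using b by (simp add: herz_block_def)
  obtain k l where kl: "\<And>z. z \<notin> dyadic_rect k l \<Longrightarrow> b z = 0"
    and le: "herz_norm (conj_exp r) (conj_exp s) (- a) (modf b) \<le> ennreal (2 powr (- \<mu> * real_of_int (k + l)))"
    using b unfolding herz_block_def by blast
  have [measurable]: "modf b \<in> borel_measurable lebesgue" unfolding modf_def by measurable
  have "(\<integral>\<^sup>+z. G z * modf b z \<partial>lebesgue)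
      = (\<integral>\<^sup>+z. (G z * indicator (dyadic_rect k l) z) * modf b z \<partial>lebesgue)"
    using kl by (intro nn_integral_cong) (auto simp: modf_def split: split_indicator)
  also have "\<dots> \<le> herz_norm r s a (\<lambda>z. G z * indicator (dyadic_rect k l) z)
      * herz_norm (conj_exp r) (conj_exp s) (- a) (modf b)"
    by (intro Holder_herz_norm rs) auto
  also have "\<dots> \<le> (ennreal (2 powr (real_of_int (k + l) * \<mu>)) * morrey_herz_norm r s a \<mu> G)
      * ennreal (2 powr (- \<mu> * real_of_int (k + l)))"
    by (intro mult_mono le herz_norm_le_morrey_herz_norm) auto
  also have "\<dots> = ennreal (2 powr (real_of_int (k + l) * \<mu>)) * ennreal (2 powr (- \<mu> * real_of_int (k + l)))
      * morrey_herz_norm r s a \<mu> G" by (simp only: mult_ac)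
  also have "ennreal (2 powr (real_of_int (k + l) * \<mu>)) * ennreal (2 powr (- \<mu> * real_of_int (k + l))) = 1"
    by (rule ennreal_powr_cancel) (simp add: mult.commute)
  finally show ?thesis by simp
qed

text \<open>The estimate for one block is summed over a block representation. The infimum in the
  block norm need not be attained, so \<open>t\<close> lies strictly above it and some
  representation has coefficient sum below \<open>t\<close>.\<close>

lemma nn_integral_mult_le_block_herz:
  fixes G u :: "('n::finite, 'm::finite) prodsp \<Rightarrow> ennreal"
  assumes [measurable]: "G \<in> borel_measurable lebesgue" and rs: "1 < r" "1 < s"
    and u: "block_herz_enorm (conj_exp r) (conj_exp s) (- a) \<mu> u < t"
  shows "(\<integral>\<^sup>+z. G z * u z \<partial>lebesgue) \<le> t * morrey_herz_norm r s a \<mu> G"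
proof -
  let ?h = "\<lambda>z. complex_of_real (enn2real (u z))"
  have fin: "AE z in lebesgue. u z < top"
    using u by (auto simp: block_herz_enorm_def split: if_splits)
  then have "block_herz_norm (conj_exp r) (conj_exp s) (- a) \<mu> ?h < t"
    using u by (simp add: block_herz_enorm_def)
  then obtain c b where cb: "block_rep (conj_exp r) (conj_exp s) (- a) \<mu> ?h c b"
    and t: "ennreal (\<Sum>k. norm (c k)) < t"
    by (auto simp: block_herz_norm_def Inf_less_iff)
  have blk: "herz_block (conj_exp r) (conj_exp s) (- a) \<mu> (b k)" for k
    using cb by (simp add: block_rep_def)
  then have [measurable]: "b k \<in> borel_measurable lebesgue" for k
    by (simp add: herz_block_def)
  have [measurable]: "modf (b k) \<in> borel_measurable lebesgue" for k
    unfolding modf_def by measurable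
  have sums: "AE z in lebesgue. (\<lambda>k. c k * b k z) sums ?h z"
    using cb by (simp add: block_rep_def)
  have "(\<integral>\<^sup>+z. G z * u z \<partial>lebesgue) \<le> (\<integral>\<^sup>+z. (\<Sum>k. ennreal (norm (c k)) * (G z * modf (b k) z)) \<partial>lebesgue)"
  proof (intro nn_integral_mono_AE, use fin sums in eventually_elim)
    case (elim z)
    have "u z = ennreal (norm (?h z))" using elim by simp
    also have "\<dots> \<le> (\<Sum>k. ennreal (norm (c k * b k z)))"
    \<comment> \<open>The representation only gives convergence of the series at \<open>z\<close>;
      where convergence is not absolute, the majorant is infinite.\<close>
    proof (cases "summable (\<lambda>k. norm (c k * b k z))")
      case True
      have "norm (?h z) \<le> (\<Sum>k. norm (c k * b k z))"
        using summable_norm[OF True] elim(2) by (simp add: sums_iff)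
      then show ?thesis using True by (simp add: suminf_ennreal2 ennreal_leI)
    next
      case False
      then have "(\<Sum>k. ennreal (norm (c k * b k z))) = top"
        by (metis summable_suminf_not_top norm_ge_zero)
      then show ?thesis by simp
    qed
    finally have "G z * u z \<le> G z * (\<Sum>k. ennreal (norm (c k * b k z)))"
      by (intro mult_left_mono) auto
    then show ?case
      by (simp add: norm_mult ennreal_mult modf_def mult_ac flip: ennreal_suminf_cmult)
  qed
  also have "\<dots> = (\<Sum>k. ennreal (norm (c k)) * (\<integral>\<^sup>+z. G z * modf (b k) z \<partial>lebesgue))"
    by (simp add: nn_integral_suminf nn_integral_cmult)
  also have "\<dots> \<le> (\<Sum>k. ennreal (norm (c k)) * morrey_herz_norm r s a \<mu> G)"
    by (intro suminf_le mult_left_mono nn_integral_mult_herz_block_le rs blk) auto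
  also have "\<dots> = ennreal (\<Sum>k. norm (c k)) * morrey_herz_norm r s a \<mu> G"
    using cb by (simp add: block_rep_def ennreal_suminf_multc suminf_ennreal2)
  also have "\<dots> \<le> t * morrey_herz_norm r s a \<mu> G"
    using t by (intro mult_right_mono) auto
  finally show ?thesis .
qed

subsection \<open>The strong maximal and the Rubio de Francia operators\<close>

lemma open_rectangles: "R \<in> rectangles \<Longrightarrow> open R"
  by (auto simp: rectangles_def intro: open_Times)

text \<open>The superlevel sets are unions of open rectangles, hence open: the maximal function is
  lower semicontinuous.\<close>

lemma measurable_strong_maximal [measurable]:
  "strong_maximal F \<in> borel_measurable lebesgue"
proof (rule borel_measurableI_greater)
  fix t :: ennreal
  have "{z \<in> space lebesgue. t < strong_maximal F z}
      = \<Union>{R \<in> rectangles. t < (\<integral>\<^sup>+ w \<in> R. F w \<partial>lebesgue) / emeasure lebesgue R}"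
    by (auto simp: strong_maximal_def less_SUP_iff)
  moreover have "open \<dots>" by (auto intro: open_rectangles)
  ultimately have "{z \<in> space lebesgue. t < strong_maximal F z} \<in> sets lborel"
    by simp
  then show "{z \<in> space lebesgue. t < strong_maximal F z} \<in> sets lebesgue"
    by (rule sets_completionI_sets)
qed

lemma measurable_strong_maximal_funpow [measurable]:
  "F \<in> borel_measurable lebesgue \<Longrightarrow> (strong_maximal ^^ k) F \<in> borel_measurable lebesgue"
  by (cases k) simp_all

lemma measurable_rubio_de_francia [measurable]:
  assumes [measurable]: "h \<in> borel_measurable lebesgue"
  shows "rubio_de_francia r s a \<mu> h \<in> borel_measurable lebesgue"
proof -
  have [measurable]: "modf h \<in> borel_measurable lebesgue" unfolding modf_def by measurable
  show ?thesis unfolding rubio_de_francia_def[abs_def] by measurable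
qed

text \<open>Averages over rectangles ignore null sets, so the maximal functions agree at every
  point. This allows an almost everywhere finite function to be exchanged for its complex
  representative.\<close>

lemma strong_maximal_cong_AE:
  assumes "AE z in lebesgue. F z = G z"
  shows "strong_maximal F = strong_maximal G"
proof -
  have "(\<integral>\<^sup>+ w \<in> R. F w \<partial>lebesgue) = (\<integral>\<^sup>+ w \<in> R. G w \<partial>lebesgue)" for R
    using assms by (intro nn_integral_cong_AE) auto
  then show ?thesis by (simp add: strong_maximal_def fun_eq_iff)
qed

lemma strong_maximal_cmult:
  assumes [measurable]: "F \<in> borel_measurable lebesgue"
  shows "strong_maximal (\<lambda>z. c * F z) z = c * strong_maximal F z"
proof -
  have "(\<integral>\<^sup>+ w \<in> R. c * F w \<partial>lebesgue) = c * (\<integral>\<^sup>+ w \<in> R. F w \<partial>lebesgue)" if "R \<in> rectangles" for R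
  proof -
    have [measurable]: "R \<in> sets lebesgue"
      using open_rectangles[OF that] by (intro sets_completionI_sets) simp
    show ?thesis by (simp add: mult.assoc nn_integral_cmult)
  qed
  then show ?thesis
    by (simp add: strong_maximal_def SUP_mult_left_ennreal ennreal_times_divide)
qed

section \<open>Homogeneity of the block norm and iterates of the strong maximal operator\<close>

lemma block_herz_norm_le:
  "block_rep r s a \<mu> h c b \<Longrightarrow> block_herz_norm r s a \<mu> h \<le> ennreal (\<Sum>k. norm (c k))"
  unfolding block_herz_norm_def by (intro Inf_lower CollectI exI[of _ c] exI[of _ b]) simp

lemma block_herz_norm_scale:
  assumes "0 < t"
  shows "block_herz_norm r s a \<mu> (\<lambda>z. complex_of_real t * h z) \<le> ennreal t * block_herz_norm r s a \<mu> h"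
proof -
  let ?x = "block_herz_norm r s a \<mu> (\<lambda>z. complex_of_real t * h z)"
  \<comment> \<open>With the factor moved to the left, the right-hand side is a bare infimum and can
    be treated one representation at a time: the coefficients are multiplied by \<open>t\<close> and
    the blocks are kept.\<close>
  have "ennreal (1 / t) * ?x \<le> block_herz_norm r s a \<mu> h"
    unfolding block_herz_norm_def[of r s a \<mu> h]
  proof (safe intro!: Inf_greatest)
    fix c b assume cb: "block_rep r s a \<mu> h c b"
    then have sm: "summable (\<lambda>k. norm (c k))" by (simp add: block_rep_def)
    have "AE z in lebesgue. (\<lambda>k. complex_of_real t * c k * b k z) sums (complex_of_real t * h z)"
    proof -
      have "AE z in lebesgue. (\<lambda>k. c k * b k z) sums h z" using cb by (simp add: block_rep_def)
      then show ?thesis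
        by eventually_elim (use sums_mult in \<open>force simp: mult.assoc\<close>)
    qed
    with cb have "block_rep r s a \<mu> (\<lambda>z. complex_of_real t * h z) (\<lambda>k. complex_of_real t * c k) b"
      by (simp add: block_rep_def norm_mult summable_mult)
    then have "?x \<le> ennreal (\<Sum>k. norm (complex_of_real t * c k))"
      by (rule block_herz_norm_le)
    also have "\<dots> = ennreal t * ennreal (\<Sum>k. norm (c k))"
      using sm assms by (simp add: norm_mult suminf_mult ennreal_mult suminf_nonneg)
    finally have "ennreal (1 / t) * ?x \<le> ennreal (1 / t) * (ennreal t * ennreal (\<Sum>k. norm (c k)))"
      by (intro mult_left_mono) auto
    also have "\<dots> = ennreal (\<Sum>k. norm (c k))"
      using assms by (simp add: mult.assoc[symmetric] flip: ennreal_mult)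
    finally show "ennreal (1 / t) * ?x \<le> ennreal (\<Sum>k. norm (c k))" .
  qed
  then have "ennreal t * (ennreal (1 / t) * ?x) \<le> ennreal t * block_herz_norm r s a \<mu> h"
    by (intro mult_left_mono) auto
  then show ?thesis
    using assms by (simp add: mult.assoc[symmetric] flip: ennreal_mult)
qed

lemma block_herz_enorm_scale:
  assumes "0 < t"
  shows "block_herz_enorm r s a \<mu> (\<lambda>z. ennreal t * u z) \<le> ennreal t * block_herz_enorm r s a \<mu> u"
proof (cases "AE z in lebesgue. u z < top")
  case True
  then have "AE z in lebesgue. ennreal t * u z < top"
    by eventually_elim (simp add: ennreal_mult_less_top)
  then show ?thesis
    using True block_herz_norm_scale[OF assms, of r s a \<mu> "\<lambda>z. complex_of_real (enn2real (u z))"] assms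
    by (simp add: block_herz_enorm_def enn2real_mult)
next
  case False
  then show ?thesis using assms by (simp add: block_herz_enorm_def ennreal_mult_top)
qed

text \<open>Lets \<open>t\<close> decrease to \<open>e\<close>. Block-norm estimates come with a
  constant strictly above the norm, because the infimum may not be attained and the norm may be
  zero, where normalising is impossible.\<close>

lemma ennreal_le_mult_limit:
  fixes x e m :: ennreal
  assumes "e < top" "m < top" and le: "\<And>t. 0 < t \<Longrightarrow> e < ennreal t \<Longrightarrow> x \<le> ennreal t * m"
  shows "x \<le> e * m"
proof (cases "m = 0")
  case True
  obtain r where "e = ennreal r" "0 \<le> r" using assms by (cases e) auto
  then show ?thesis using le[of "r + 1"] True by (simp add: ennreal_less_iff)
next
  case False
  have "x / m \<le> e"
  proof (rule dense_ge)
    fix t assume "e < t"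
    show "x / m \<le> t"
    proof (cases t)
      case (real s)
      then have "0 < s" using \<open>e < t\<close> by (metis ennreal_neg less_le_not_le not_less zero_le)
      with le[of s] real False \<open>e < t\<close> show ?thesis
        by (intro divide_le_posI_ennreal) (auto simp: zero_less_iff_neq_zero mult.commute)
    qed simp
  qed
  then have "x / m * m \<le> e * m" by (intro mult_right_mono) auto
  then show ?thesis using False assms by (simp add: ennreal_divide_times ennreal_mult_divide_eq)
qed

text \<open>The operator norm is a supremum over complex functions in the unit ball. So
  \<open>u\<close> is divided by some \<open>t\<close> above its norm and replaced by a complex
  representative \<open>h\<close>; homogeneity undoes the division, and \<open>t\<close> then tends
  to the norm of \<open>u\<close>.\<close>

lemma block_herz_enorm_strong_maximal_le:
  fixes u :: "('n::finite, 'm::finite) prodsp \<Rightarrow> ennreal"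
  defines "N \<equiv> strong_maximal_opnorm TYPE('n) TYPE('m)"
  assumes [measurable]: "u \<in> borel_measurable lebesgue"
    and fin: "block_herz_enorm r s a \<mu> u < top" "N r s a \<mu> < top"
  shows "block_herz_enorm r s a \<mu> (strong_maximal u) \<le> block_herz_enorm r s a \<mu> u * N r s a \<mu>"
proof (rule ennreal_le_mult_limit[OF fin])
  fix t assume t: "0 < t" and le: "block_herz_enorm r s a \<mu> u < ennreal t"
  define w where "w = (\<lambda>z. ennreal (1 / t) * u z)"
  define h where "h = (\<lambda>z. complex_of_real (enn2real (w z)))"
  have "block_herz_enorm r s a \<mu> w \<le> ennreal (1 / t) * block_herz_enorm r s a \<mu> u"
    unfolding w_def using t by (intro block_herz_enorm_scale) simp
  also have "\<dots> \<le> ennreal (1 / t) * ennreal t"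
    using le by (intro mult_left_mono) auto
  also have "\<dots> = 1" using t by (simp flip: ennreal_mult)
  finally have w1: "block_herz_enorm r s a \<mu> w \<le> 1" .
  then have wfin: "AE z in lebesgue. w z < top"
    by (auto simp: block_herz_enorm_def top_unique split: if_splits)
  then have "AE z in lebesgue. modf h z = w z"
    by eventually_elim (simp add: modf_def h_def)
  from strong_maximal_cong_AE[OF this]
  have M: "strong_maximal (modf h) = (\<lambda>z. ennreal (1 / t) * strong_maximal u z)"
    by (simp add: w_def strong_maximal_cmult fun_eq_iff)
  have "block_herz_norm r s a \<mu> h \<le> 1"
    using w1 wfin by (simp add: block_herz_enorm_def h_def)
  then have "block_herz_enorm r s a \<mu> (strong_maximal (modf h)) \<le> N r s a \<mu>"
    unfolding N_def strong_maximal_opnorm_def by (intro SUP_upper) simp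
  then have "ennreal t * block_herz_enorm r s a \<mu> (\<lambda>z. ennreal (1 / t) * strong_maximal u z)
      \<le> ennreal t * N r s a \<mu>"
    unfolding M by (intro mult_left_mono) auto
  moreover have "strong_maximal u = (\<lambda>z. ennreal t * (ennreal (1 / t) * strong_maximal u z))"
    using t by (simp add: mult.assoc[symmetric] flip: ennreal_mult)
  then have "block_herz_enorm r s a \<mu> (strong_maximal u)
      \<le> ennreal t * block_herz_enorm r s a \<mu> (\<lambda>z. ennreal (1 / t) * strong_maximal u z)"
    using block_herz_enorm_scale[OF t] by metis
  ultimately show "block_herz_enorm r s a \<mu> (strong_maximal u) \<le> ennreal t * N r s a \<mu>"
    by (rule order_trans[rotated])
qed

lemma block_herz_enorm_strong_maximal_funpow_le:
  fixes u :: "('n::finite, 'm::finite) prodsp \<Rightarrow> ennreal"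
  defines "N \<equiv> strong_maximal_opnorm TYPE('n) TYPE('m)"
  assumes [measurable]: "u \<in> borel_measurable lebesgue"
    and u: "block_herz_enorm r s a \<mu> u \<le> 1" and N: "N r s a \<mu> < top"
  shows "block_herz_enorm r s a \<mu> ((strong_maximal ^^ k) u) \<le> N r s a \<mu> ^ k"
proof (induction k)
  case 0
  show ?case using u by simp
next
  case (Suc k)
  have "N r s a \<mu> ^ k < top"
    using N by (simp add: power_less_top_ennreal)
  then have "block_herz_enorm r s a \<mu> ((strong_maximal ^^ k) u) < top"
    using Suc.IH by (rule le_less_trans[rotated])
  then have "block_herz_enorm r s a \<mu> (strong_maximal ((strong_maximal ^^ k) u))
      \<le> block_herz_enorm r s a \<mu> ((strong_maximal ^^ k) u) * N r s a \<mu>"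
    using N unfolding N_def by (intro block_herz_enorm_strong_maximal_le) auto
  also have "\<dots> \<le> N r s a \<mu> ^ k * N r s a \<mu>"
    by (intro mult_right_mono Suc.IH) auto
  finally show ?case by (simp add: mult.commute)
qed

text \<open>A block represents itself with coefficient one, padded by zero coefficients. Blocks are
  therefore admissible in the hypothesis of the extrapolation theorem.\<close>

lemma herz_block_norm_le_1:
  assumes "herz_block r s a \<mu> b"
  shows "block_herz_norm r s a \<mu> b \<le> 1"
proof -
  let ?c = "\<lambda>k. if k = 0 then 1 else 0 :: complex"
  have "(\<lambda>k. norm (?c k)) sums 1"
    using sums_single[of 0 "\<lambda>_. 1 :: real"] by (simp add: if_distrib cong: if_cong)
  moreover have "(\<lambda>k. ?c k * b z) sums b z" for z
    using sums_single[of 0 "\<lambda>_. b z"] by (simp add: if_distrib if_distribR cong: if_cong)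
  ultimately have "block_rep r s a \<mu> b ?c (\<lambda>_. b)" "(\<Sum>k. norm (?c k)) = 1"
    using assms by (auto simp: block_rep_def sums_iff)
  then show ?thesis
    using block_herz_norm_le[of r s a \<mu> b ?c "\<lambda>_. b"] by simp
qed

text \<open>If the strong maximal operator has infinite norm, all terms but the first of the series
  defining the Rubio de Francia operator vanish, since \<open>x / \<infinity> = 0\<close>.\<close>

lemma nn_integral_mult_rubio_de_francia_le:
  fixes G :: "('n::finite, 'm::finite) prodsp \<Rightarrow> ennreal"
  assumes [measurable]: "G \<in> borel_measurable lebesgue" and rs: "1 < r" "1 < s"
    and b: "herz_block (conj_exp r) (conj_exp s) (- a) \<mu> b"
  shows "(\<integral>\<^sup>+z. G z * rubio_de_francia (conj_exp r) (conj_exp s) (- a) \<mu> b z \<partial>lebesgue)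
    \<le> 2 * morrey_herz_norm r s a \<mu> G"
proof (cases "morrey_herz_norm r s a \<mu> G = top")
  case True
  then show ?thesis by (simp add: ennreal_mult_top)
next
  case False
  define m where "m = morrey_herz_norm r s a \<mu> G"
  have m: "m < top" using False by (simp add: m_def less_top)
  define N where "N = strong_maximal_opnorm TYPE('n) TYPE('m) (conj_exp r) (conj_exp s) (- a) \<mu>"
  have [measurable]: "b \<in> borel_measurable lebesgue" using b by (simp add: herz_block_def)
  have [measurable]: "modf b \<in> borel_measurable lebesgue" unfolding modf_def by measurable
  \<comment> \<open>The norm and the support condition involve only the modulus, so the modulus of a
    block is a block. This puts \<open>modf b\<close> into the unit ball.\<close>
  have "herz_block (conj_exp r) (conj_exp s) (- a) \<mu> (\<lambda>z. complex_of_real (norm (b z)))"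
    using b by (auto simp: herz_block_def modf_def)
  then have b1: "block_herz_enorm (conj_exp r) (conj_exp s) (- a) \<mu> (modf b) \<le> 1"
    using herz_block_norm_le_1 by (simp add: block_herz_enorm_def modf_def)
  have summand: "(\<integral>\<^sup>+z. G z * ((strong_maximal ^^ k) (modf b) z / (2 ^ k * N ^ k)) \<partial>lebesgue)
      \<le> m * ennreal ((1 / 2) ^ k)" for k
  proof (cases "N = top")
    case True
    show ?thesis
    proof (cases k)
      case 0
      then show ?thesis
        using nn_integral_mult_herz_block_le[OF assms] by (simp add: m_def divide_ennreal_def)
    next
      case (Suc j)
      then show ?thesis using True by (simp add: ennreal_mult_top ennreal_top_mult power_eq_top_ennreal)
    qed
  next
    case False
    then have N: "N < top" "N ^ k < top" by (simp_all add: less_top power_less_top_ennreal)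
    let ?e = "block_herz_enorm (conj_exp r) (conj_exp s) (- a) \<mu> ((strong_maximal ^^ k) (modf b))"
    have e: "?e \<le> N ^ k"
      using N b1 unfolding N_def by (intro block_herz_enorm_strong_maximal_funpow_le) auto
    have "(\<integral>\<^sup>+z. G z * (strong_maximal ^^ k) (modf b) z \<partial>lebesgue) \<le> ?e * m"
    proof (rule ennreal_le_mult_limit)
      show "?e < top" using e N(2) by (rule le_less_trans)
      fix t assume "?e < ennreal t"
      then show "(\<integral>\<^sup>+z. G z * (strong_maximal ^^ k) (modf b) z \<partial>lebesgue) \<le> ennreal t * m"
        unfolding m_def using assms(1) rs by (intro nn_integral_mult_le_block_herz)
    qed (rule m)
    also have "\<dots> \<le> N ^ k * m"
      using e by (intro mult_right_mono) auto
    finally have "(\<integral>\<^sup>+z. G z * (strong_maximal ^^ k) (modf b) z \<partial>lebesgue) / (2 ^ k * N ^ k)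
        \<le> N ^ k * m / (2 ^ k * N ^ k)"
      by (intro divide_right_mono_ennreal)
    \<comment> \<open>The power of the operator norm cancels and leaves the geometric weight. If
      that power is zero, the left-hand side is zero, as \<open>0 / 0 = 0\<close> in
      \<open>ennreal\<close>.\<close>
    also have "\<dots> \<le> m / 2 ^ k"
    proof (cases "N ^ k = 0")
      case False
      then have "m * N ^ k / (2 ^ k * N ^ k) = m / 2 ^ k"
        using N by (intro divide_mult_eq) auto
      then show ?thesis by (simp add: mult.commute)
    next
      case True
      then show ?thesis by (simp only: mult_zero_left) simp
    qed
    also have "\<dots> = m * ennreal ((1 / 2) ^ k)"
    proof -
      have "(2 :: ennreal) ^ k = ennreal (2 ^ k)" by (simp flip: ennreal_power)
      then show ?thesis
        by (simp add: divide_ennreal_def inverse_ennreal power_one_over inverse_eq_divide)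
    qed
    finally show ?thesis
      by (simp add: ennreal_times_divide nn_integral_divide)
  qed
  have "(\<integral>\<^sup>+z. G z * rubio_de_francia (conj_exp r) (conj_exp s) (- a) \<mu> b z \<partial>lebesgue)
      = (\<integral>\<^sup>+z. (\<Sum>k. G z * ((strong_maximal ^^ k) (modf b) z / (2 ^ k * N ^ k))) \<partial>lebesgue)"
    by (simp add: rubio_de_francia_def N_def)
  also have "\<dots> = (\<Sum>k. (\<integral>\<^sup>+z. G z * ((strong_maximal ^^ k) (modf b) z / (2 ^ k * N ^ k)) \<partial>lebesgue))"
    by (intro nn_integral_suminf) measurable
  also have "\<dots> \<le> (\<Sum>k. m * ennreal ((1 / 2) ^ k))"
    by (intro suminf_le summand) auto
  also have "\<dots> = m * ennreal 2"
    by (simp add: suminf_ennreal2 suminf_geometric)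
  finally show ?thesis by (simp add: m_def mult.commute)
qed

subsection \<open>Duality\<close>

lemma Lr_norm_SUP:
  fixes f :: "nat \<Rightarrow> ('n::finite, 'm::finite) prodsp \<Rightarrow> ennreal"
  assumes [measurable]: "\<And>n. f n \<in> borel_measurable lebesgue"
    and "0 < r" and f: "\<And>z. incseq (\<lambda>n. f n z)"
  shows "Lr_norm r (\<lambda>z. SUP n. f n z) = (SUP n. Lr_norm r (f n))"
proof -
  have "incseq (\<lambda>n z. f n z epowr r)"
    using f \<open>0 < r\<close> by (auto simp: incseq_def le_fun_def intro!: epowr_mono)
  then have "(\<integral>\<^sup>+z. (SUP n. f n z epowr r) \<partial>lebesgue) = (SUP n. \<integral>\<^sup>+z. f n z epowr r \<partial>lebesgue)"
    by (intro nn_integral_monotone_convergence_SUP) auto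
  then show ?thesis
    using \<open>0 < r\<close> by (simp add: Lr_norm_def SUP_epowr)
qed

lemma Lr_norm_mono: "0 < r \<Longrightarrow> (\<And>z. F z \<le> G z) \<Longrightarrow> Lr_norm r F \<le> Lr_norm r G"
  unfolding Lr_norm_def by (simp add: epowr_mono nn_integral_mono)

text \<open>Here \<open>n\<close> stands for i + j and \<open>\<rho>\<close> for the integral of the
  \<open>r\<close>-th power over a product of shells. The left side is the summand of the dual Herz
  norm of the norming function, before the factor \<open>K\<close>; the right side is the summand
  for the original function.\<close>

lemma norming_exponents:
  assumes r: "1 < r" and s: "1 < s" and "0 \<le> \<rho>"
  shows "2 powr (n * conj_exp s * (- a)) *
      (2 powr (n * s * a) * \<rho> powr (s / r - 1) * \<rho> powr (1 / conj_exp r)) powr conj_exp s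
    = 2 powr (n * s * a) * \<rho> powr (s / r)"
proof -
  have e: "s / r - 1 + 1 / conj_exp r = (s - 1) / r"
    using conj_exp(2)[OF r] by (simp add: diff_divide_distrib)
  have s': "(s - 1) * conj_exp s = s" using s by (simp add: conj_exp_def)
  have "\<rho> powr (s / r - 1) * \<rho> powr (1 / conj_exp r) = \<rho> powr ((s - 1) / r)"
    using e by (simp flip: powr_add)
  then have "(2 powr (n * s * a) * \<rho> powr (s / r - 1) * \<rho> powr (1 / conj_exp r)) powr conj_exp s
      = 2 powr (n * s * a * conj_exp s) * \<rho> powr ((s - 1) / r * conj_exp s)"
    using \<open>0 \<le> \<rho>\<close> by (simp add: mult.assoc powr_mult powr_powr)
  also have "(s - 1) / r * conj_exp s = s / r" using s' by simp
  finally have "2 powr (n * conj_exp s * (- a)) *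
      (2 powr (n * s * a) * \<rho> powr (s / r - 1) * \<rho> powr (1 / conj_exp r)) powr conj_exp s
    = 2 powr (n * conj_exp s * (- a) + n * s * a * conj_exp s) * \<rho> powr (s / r)"
    by (simp only: powr_add mult.assoc)
  also have "n * conj_exp s * (- a) + n * s * a * conj_exp s = n * a * ((s - 1) * conj_exp s)"
    by (simp add: algebra_simps)
  also have "\<dots> = n * s * a" unfolding s' by (simp add: mult_ac)
  finally show ?thesis .
qed

text \<open>The norming block is \<open>K \<Sum> c\<^sub>i\<^sub>j \<phi>\<^sup>r\<^sup>-\<^sup>1\<close> on the shells in \<open>S\<close>, where \<open>K\<close> and the \<open>c\<^sub>i\<^sub>j\<close> are chosen for
  equality in the Hoelder inequalities in the integral and in the sum.\<close>

lemma finite_herz_sum_le_dual: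
  fixes \<phi> :: "('n::finite, 'm::finite) prodsp \<Rightarrow> real"
  defines "X \<equiv> \<lambda>ij :: int \<times> int. indicator (shell (fst ij) \<times> shell (snd ij)) :: ('n, 'm) prodsp \<Rightarrow> ennreal"
  assumes [measurable]: "\<phi> \<in> borel_measurable lebesgue" and \<phi>0: "\<And>z. 0 \<le> \<phi> z"
    and supp: "\<And>z. z \<notin> dyadic_rect k l \<Longrightarrow> \<phi> z = 0"
    and fin: "(\<integral>\<^sup>+z. ennreal (\<phi> z powr r) \<partial>lebesgue) < top"
    and r: "1 < r" and s: "1 < s" and S: "finite S"
    and D: "\<And>b. herz_block (conj_exp r) (conj_exp s) (- a) \<mu> b \<Longrightarrow> (\<integral>\<^sup>+z. ennreal (\<phi> z) * modf b z \<partial>lebesgue) \<le> D"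
  shows "(\<Sum>ij\<in>S. ennreal (2 powr (real_of_int (fst ij + snd ij) * s * a)) * Lr_norm r (\<lambda>z. ennreal (\<phi> z) * X ij z) epowr s)
    \<le> (ennreal (2 powr (real_of_int (k + l) * \<mu>)) * D) epowr s"
proof -
  let ?n = "\<lambda>ij :: int \<times> int. real_of_int (fst ij + snd ij)"
  let ?sh = "\<lambda>ij :: int \<times> int. shell (fst ij) \<times> shell (snd ij) :: ('n, 'm) prodsp set"
  let ?r = "conj_exp r" and ?s = "conj_exp s"
  note r' = conj_exp[OF r] and s' = conj_exp[OF s]
  have [measurable]: "X ij \<in> borel_measurable lebesgue" for ij by (simp add: X_def)
  define \<rho> where "\<rho> ij = enn2real (\<integral>\<^sup>+z. ennreal (\<phi> z powr r) * X ij z \<partial>lebesgue)" for ij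
  have \<rho>0: "0 \<le> \<rho> ij" for ij by (simp add: \<rho>_def)
  have \<rho>: "(\<integral>\<^sup>+z. ennreal (\<phi> z powr r) * X ij z \<partial>lebesgue) = ennreal (\<rho> ij)" for ij
  proof -
    have "(\<integral>\<^sup>+z. ennreal (\<phi> z powr r) * X ij z \<partial>lebesgue) \<le> (\<integral>\<^sup>+z. ennreal (\<phi> z powr r) \<partial>lebesgue)"
      by (intro nn_integral_mono) (simp add: X_def split: split_indicator)
    then show ?thesis using fin by (auto simp: \<rho>_def)
  qed
  \<comment> \<open>This weight gives equality in the Hoelder inequality for the sum. Where
    \<open>\<rho> ij = 0\<close> it is zero even if the exponent is negative, since
    \<open>0 powr x = 0\<close> for all x.\<close>
  define c where "c ij = 2 powr (?n ij * s * a) * \<rho> ij powr (s / r - 1)" for ij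
  have c0: "0 \<le> c ij" for ij by (simp add: c_def)
  \<comment> \<open>\<open>w ij\<close> is the summand of the \<open>s\<close>-th power of the Herz
    norm of \<open>\<phi>\<close>, so \<open>T\<close> is the partial sum to be bounded.\<close>
  define w where "w ij = 2 powr (?n ij * s * a) * \<rho> ij powr (s / r)" for ij
  define T where "T = (\<Sum>ij\<in>S. w ij)"
  have "0 \<le> T" by (simp add: T_def w_def sum_nonneg)
  have "ennreal (2 powr (?n ij * s * a)) * Lr_norm r (\<lambda>z. ennreal (\<phi> z) * X ij z) epowr s = ennreal (w ij)" for ij
  proof -
    have "(\<integral>\<^sup>+z. (ennreal (\<phi> z) * X ij z) epowr r \<partial>lebesgue) = ennreal (\<rho> ij)"
      unfolding \<rho>[symmetric] using \<phi>0
      by (intro nn_integral_cong) (simp add: X_def epowr_ennreal split: split_indicator)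
    then have "Lr_norm r (\<lambda>z. ennreal (\<phi> z) * X ij z) epowr s = ennreal (\<rho> ij powr (s / r))"
      using \<rho>0 by (simp add: Lr_norm_def epowr_ennreal powr_powr)
    then show ?thesis by (simp add: w_def ennreal_mult)
  qed
  then have "(\<Sum>ij\<in>S. ennreal (2 powr (?n ij * s * a)) * Lr_norm r (\<lambda>z. ennreal (\<phi> z) * X ij z) epowr s) = ennreal T"
    by (simp add: T_def w_def)
  moreover have "ennreal T \<le> (ennreal (2 powr (real_of_int (k + l) * \<mu>)) * D) epowr s"
  proof (cases "T = 0")
    case False
    then have "0 < T" using \<open>0 \<le> T\<close> by simp
    \<comment> \<open>Without \<open>K\<close> the dual Herz norm would be T^(1/s') = T^(1-1/s),
      with s' the conjugate of s. This \<open>K\<close> makes it exactly the size allowed for a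
      block supported in the rectangle (k, l).\<close>
    define K where "K = 2 powr (- \<mu> * real_of_int (k + l)) * T powr (1 / s - 1)"
    have "0 < K" using \<open>0 < T\<close> by (simp add: K_def)
    define \<beta> where "\<beta> z = (\<Sum>ij\<in>S. K * c ij * \<phi> z powr (r - 1) * indicator (?sh ij) z)" for z
    define b where "b z = complex_of_real (\<beta> z)" for z
    have \<beta>0: "0 \<le> \<beta> z" for z
      using \<open>0 < K\<close> by (auto simp: \<beta>_def c_def intro!: sum_nonneg)
    have \<beta>_meas [measurable]: "\<beta> \<in> borel_measurable lebesgue"
      unfolding \<beta>_def[abs_def] by measurable
    have modf_b: "modf b z = ennreal (\<beta> z)" for z
      using \<beta>0 by (simp add: modf_def b_def)
    have on_shell: "\<beta> z = (if ij \<in> S then K * c ij * \<phi> z powr (r - 1) else 0)" if z: "z \<in> ?sh ij" for z ij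
    proof -
      \<comment> \<open>Shells are disjoint, so at a given point at most one summand of
        \<open>\<beta>\<close> survives.\<close>
      have "indicator (?sh ij') z = (if ij' = ij then 1 else 0 :: real)" for ij'
        using z shell_disjoint[of "fst z"] shell_disjoint[of "snd z"] by (auto simp: indicator_def mem_Times_iff prod_eq_iff)
      then have "\<beta> z = (\<Sum>ij'\<in>S. if ij' = ij then K * c ij * \<phi> z powr (r - 1) else 0)"
        unfolding \<beta>_def by (intro sum.cong refl) simp
      then show ?thesis using S by simp
    qed
    have Lr: "Lr_norm ?r (\<lambda>z. modf b z * X ij z) = ennreal (K * c ij * \<rho> ij powr (1 / ?r))"
      if "ij \<in> S" for ij
    proof -
      have Kc: "0 \<le> K * c ij" using \<open>0 < K\<close> by (simp add: c_def)
      have "(r - 1) * ?r = r" using r by (simp add: conj_exp_def)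
      then have e: "(K * c ij * \<phi> z powr (r - 1)) powr ?r = (K * c ij) powr ?r * \<phi> z powr r" for z
        using Kc by (simp only: powr_mult powr_powr powr_ge_zero)
      have "(modf b z * X ij z) epowr ?r = ennreal ((K * c ij) powr ?r) * (ennreal (\<phi> z powr r) * X ij z)" for z
      proof (cases "z \<in> ?sh ij")
        case True
        then have "modf b z * X ij z = ennreal (K * c ij * \<phi> z powr (r - 1))"
          using that by (simp only: modf_b on_shell X_def) simp
        then have "(modf b z * X ij z) epowr ?r = ennreal ((K * c ij) powr ?r * \<phi> z powr r)"
          using Kc by (simp only: e epowr_ennreal mult_nonneg_nonneg powr_ge_zero)
        then show ?thesis using True by (simp only: X_def ennreal_mult powr_ge_zero) simp
      qed (simp add: X_def)
      then have "(\<integral>\<^sup>+z. (modf b z * X ij z) epowr ?r \<partial>lebesgue) = ennreal ((K * c ij) powr ?r * \<rho> ij)"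
        by (simp add: nn_integral_cmult \<rho> ennreal_mult \<rho>0)
      then show ?thesis
        using Kc \<rho>0 r' \<open>0 < K\<close> c0 by (simp add: Lr_norm_def epowr_ennreal powr_mult powr_powr)
    qed
    have "herz_norm ?r ?s (- a) (modf b)
        = (\<Sum>ij\<in>S. ennreal (2 powr (?n ij * ?s * (- a))) * Lr_norm ?r (\<lambda>z. modf b z * X ij z) epowr ?s) epowr (1 / ?s)"
      unfolding herz_norm_eq_nn_integral X_def
    proof (intro arg_cong[of _ _ "\<lambda>x. x epowr (1 / ?s)"] nn_integral_count_space' S)
      fix ij assume "ij \<notin> S"
      then have "(\<lambda>z. modf b z * indicator (?sh ij) z) = (\<lambda>_. 0)"
        by (auto simp: modf_b on_shell split: split_indicator)
      then show "ennreal (2 powr (?n ij * ?s * (- a))) * Lr_norm ?r (\<lambda>z. modf b z * indicator (?sh ij) z) epowr ?s = 0"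
        by (simp add: Lr_norm_def)
    qed auto
    also have "(\<Sum>ij\<in>S. ennreal (2 powr (?n ij * ?s * (- a))) * Lr_norm ?r (\<lambda>z. modf b z * X ij z) epowr ?s)
        = (\<Sum>ij\<in>S. ennreal (K powr ?s * w ij))"
    proof (intro sum.cong refl)
      fix ij assume "ij \<in> S"
      have "2 powr (?n ij * ?s * (- a)) * (K * c ij * \<rho> ij powr (1 / ?r)) powr ?s = K powr ?s * w ij"
        using norming_exponents[OF r s \<rho>0, of "?n ij" a ij] \<open>0 < K\<close>
        by (simp add: c_def w_def powr_mult mult_ac)
      then show "ennreal (2 powr (?n ij * ?s * (- a))) * Lr_norm ?r (\<lambda>z. modf b z * X ij z) epowr ?s
          = ennreal (K powr ?s * w ij)"
        using \<open>ij \<in> S\<close> \<open>0 < K\<close> by (simp add: Lr epowr_ennreal c_def flip: ennreal_mult)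
    qed
    also have "\<dots> = ennreal (K powr ?s * T)"
      by (simp add: T_def w_def sum_distrib_left)
    also have "ennreal (K powr ?s * T) epowr (1 / ?s) = ennreal (K * T powr (1 / ?s))"
      using \<open>0 < K\<close> \<open>0 < T\<close> s' by (simp add: epowr_ennreal powr_mult powr_powr)
    also have "K * T powr (1 / ?s) = 2 powr (- \<mu> * real_of_int (k + l))"
    proof -
      have "1 / s - 1 + 1 / ?s = 0" using s' by simp
      then have "T powr (1 / s - 1) * T powr (1 / ?s) = 1"
        using \<open>0 < T\<close> by (metis less_irrefl powr_add powr_zero_eq_one)
      then show ?thesis by (simp add: K_def mult.assoc)
    qed
    finally have "herz_norm ?r ?s (- a) (modf b) = ennreal (2 powr (- \<mu> * real_of_int (k + l)))" .
    moreover have "b z = 0" if "z \<notin> dyadic_rect k l" for z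
      using supp[OF that] by (simp add: b_def \<beta>_def)
    moreover have "b \<in> borel_measurable lebesgue"
      unfolding b_def[abs_def] by measurable
    ultimately have "herz_block ?r ?s (- a) \<mu> b"
      unfolding herz_block_def by (metis order_refl)
    then have "(\<integral>\<^sup>+z. ennreal (\<phi> z) * modf b z \<partial>lebesgue) \<le> D" by (rule D)
    \<comment> \<open>The pairing recovers the partial sum: the powers of \<open>\<phi>\<close>
      combine to \<open>\<phi> z powr r\<close>, whose integral is \<open>\<rho> ij\<close>, and
      \<open>c ij * \<rho> ij = w ij\<close>.\<close>
    moreover have "(\<integral>\<^sup>+z. ennreal (\<phi> z) * modf b z \<partial>lebesgue) = ennreal (K * T)"
    proof -
      have "\<phi> z * \<phi> z powr (r - 1) = \<phi> z powr r" for z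
        using \<phi>0[of z] by (simp add: powr_mult_base)
      then have "ennreal (\<phi> z) * modf b z = (\<Sum>ij\<in>S. ennreal (K * c ij) * (ennreal (\<phi> z powr r) * X ij z))" for z
      proof -
        have "\<phi> z * \<beta> z = (\<Sum>ij\<in>S. (K * c ij) * ((\<phi> z * \<phi> z powr (r - 1)) * indicator (?sh ij) z))"
          by (simp add: \<beta>_def sum_distrib_left mult_ac)
        also have "\<dots> = (\<Sum>ij\<in>S. (K * c ij) * (\<phi> z powr r * indicator (?sh ij) z))"
          by (simp add: \<open>\<phi> z * \<phi> z powr (r - 1) = \<phi> z powr r\<close>)
        finally have "ennreal (\<phi> z * \<beta> z) = (\<Sum>ij\<in>S. ennreal ((K * c ij) * (\<phi> z powr r * indicator (?sh ij) z)))"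
          using \<open>0 < K\<close> by (simp add: c_def)
        then show ?thesis
          using \<phi>0 \<beta>0 \<open>0 < K\<close> by (simp add: modf_b X_def c_def ennreal_mult ennreal_indicator)
      qed
      then have "(\<integral>\<^sup>+z. ennreal (\<phi> z) * modf b z \<partial>lebesgue) = (\<Sum>ij\<in>S. ennreal (K * c ij) * ennreal (\<rho> ij))"
        by (simp add: nn_integral_sum nn_integral_cmult flip: \<rho>)
      also have "\<dots> = (\<Sum>ij\<in>S. ennreal (K * w ij))"
      proof (intro sum.cong refl)
        fix ij
        have "\<rho> ij powr (s / r - 1) * \<rho> ij = \<rho> ij powr (s / r)"
          using \<rho>0[of ij] by (simp add: powr_mult_base mult.commute)
        then have "K * c ij * \<rho> ij = K * w ij" by (simp add: c_def w_def mult_ac)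
        then show "ennreal (K * c ij) * ennreal (\<rho> ij) = ennreal (K * w ij)"
          using \<rho>0 \<open>0 < K\<close> c0 by (simp add: mult.assoc flip: ennreal_mult)
      qed
      also have "\<dots> = ennreal (K * T)"
        using \<open>0 < K\<close> by (simp add: T_def w_def sum_distrib_left)
      finally show ?thesis .
    qed
    ultimately have "ennreal (K * T) \<le> D" by simp
    then have "ennreal (2 powr (real_of_int (k + l) * \<mu>)) * ennreal (K * T) \<le> ennreal (2 powr (real_of_int (k + l) * \<mu>)) * D"
      by (intro mult_left_mono) auto
    \<comment> \<open>Multiplying by the inverse weight removes the block size from \<open>K\<close>
      and leaves the \<open>s\<close>-th root of the partial sum.\<close>
    moreover have "2 powr (real_of_int (k + l) * \<mu>) * (K * T) = T powr (1 / s)"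
    proof -
      have "T powr (1 / s - 1) * T = T powr (1 / s)"
        using \<open>0 < T\<close> by (simp add: powr_mult_base mult.commute)
      moreover have "2 powr (real_of_int (k + l) * \<mu>) * 2 powr (- \<mu> * real_of_int (k + l)) = 1"
        by (simp add: powr_minus mult.commute)
      ultimately show ?thesis by (simp add: K_def mult.assoc[symmetric])
    qed
    ultimately have "ennreal T epowr (1 / s) \<le> ennreal (2 powr (real_of_int (k + l) * \<mu>)) * D"
      using \<open>0 < T\<close> \<open>0 < K\<close> by (simp add: epowr_ennreal flip: ennreal_mult)
    then show ?thesis
      using s by (subst (asm) epowr_le_iff) auto
  qed simp
  ultimately show ?thesis by simp
qed

text \<open>The bound for finitely many shells is applied to truncations of \<open>F\<close> on the
  rectangle. Monotone convergence removes the truncation, and the unordered sum is the supremum of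
  its finite partial sums.\<close>

lemma herz_norm_le_dual:
  fixes F :: "('n::finite, 'm::finite) prodsp \<Rightarrow> ennreal"
  assumes [measurable]: "F \<in> borel_measurable lebesgue" and r: "1 < r" and s: "1 < s"
    and D: "\<And>b. herz_block (conj_exp r) (conj_exp s) (- a) \<mu> b \<Longrightarrow> (\<integral>\<^sup>+z. F z * modf b z \<partial>lebesgue) \<le> D"
  shows "herz_norm r s a (\<lambda>z. F z * indicator (dyadic_rect k l) z) \<le> ennreal (2 powr (real_of_int (k + l) * \<mu>)) * D"
proof -
  define c where "c ij = ennreal (2 powr (real_of_int (fst ij + snd ij) * s * a))" for ij :: "int \<times> int"
  let ?sh = "\<lambda>ij. shell (fst ij) \<times> shell (snd ij) :: ('n, 'm) prodsp set"
  \<comment> \<open>Cutting off at height \<open>n\<close> on a bounded rectangle makes the function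
    real-valued with finite \<open>r\<close>-th power integral, even where \<open>F\<close> is
    infinite.\<close>
  define \<phi> where "\<phi> n z = enn2real (min (F z) (of_nat n)) * indicator (dyadic_rect k l) z" for n :: nat and z
  have [measurable]: "\<phi> n \<in> borel_measurable lebesgue" for n
    unfolding \<phi>_def[abs_def] by measurable
  have \<phi>0: "0 \<le> \<phi> n z" for n z by (simp add: \<phi>_def)
  have \<phi>n: "\<phi> n z \<le> real n * indicator (dyadic_rect k l) z" for n z
  proof -
    have "enn2real (min (F z) (of_nat n)) \<le> real n"
      by (metis enn2real_mono enn2real_of_nat min.cobounded2 of_nat_less_top)
    then show ?thesis by (simp add: \<phi>_def split: split_indicator)
  qed
  have \<phi>: "ennreal (\<phi> n z) = min (F z) (of_nat n) * indicator (dyadic_rect k l) z" for n z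
  proof -
    have "min (F z) (of_nat n) < top" by (simp add: min_less_iff_disj of_nat_less_top)
    then show ?thesis by (simp add: \<phi>_def split: split_indicator)
  qed
  have inc: "incseq (\<lambda>n. ennreal (\<phi> n z))" for z
    unfolding \<phi> by (auto simp: incseq_def intro!: mult_right_mono min.mono)
  have sup: "(SUP n. ennreal (\<phi> n z)) = F z * indicator (dyadic_rect k l) z" for z
  proof -
    have "(SUP n. min (F z) (of_nat n)) = F z"
    proof -
      have "(SUP n. inf (F z) (of_nat n)) = inf (F z) (SUP n. of_nat n)"
        by (simp add: inf_SUP)
      then show ?thesis by (simp add: ennreal_SUP_of_nat_eq_top inf_min)
    qed
    then show ?thesis unfolding \<phi> by (simp flip: SUP_mult_right_ennreal)
  qed
  have fin: "(\<integral>\<^sup>+z. ennreal (\<phi> n z powr r) \<partial>lebesgue) < top" for n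
  proof -
    have "bounded (dyadic_rect k l :: ('n, 'm) prodsp set)"
      by (simp add: dyadic_rect_def dyadic_cube_def bounded_Times)
    then have "emeasure lebesgue (dyadic_rect k l :: ('n, 'm) prodsp set) < top"
      using bounded_set_imp_lmeasurable[of "dyadic_rect k l :: ('n, 'm) prodsp set"]
      by (simp add: fmeasurable_def)
    moreover have bound: "ennreal (\<phi> n z powr r) \<le> ennreal (real n powr r) * indicator (dyadic_rect k l) z" for z
      using \<phi>0[of n z] \<phi>n[of n z] r by (auto simp: powr_mono2 ennreal_leI split: split_indicator_asm split_indicator)
    have "(\<integral>\<^sup>+z. ennreal (\<phi> n z powr r) \<partial>lebesgue)
        \<le> (\<integral>\<^sup>+z. ennreal (real n powr r) * indicator (dyadic_rect k l :: ('n, 'm) prodsp set) z \<partial>lebesgue)"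
      by (intro nn_integral_mono bound)
    ultimately show ?thesis
      by (auto simp: nn_integral_cmult_indicator ennreal_mult_less_top intro: le_less_trans)
  qed
  have part: "(\<Sum>ij\<in>S. c ij * Lr_norm r (\<lambda>z. ennreal (\<phi> n z) * indicator (?sh ij) z) epowr s)
      \<le> (ennreal (2 powr (real_of_int (k + l) * \<mu>)) * D) epowr s" if "finite S" for S n
    unfolding c_def
  proof (rule finite_herz_sum_le_dual[OF _ \<phi>0 _ fin r s that])
    fix b :: "('n, 'm) prodsp \<Rightarrow> complex"
    assume b: "herz_block (conj_exp r) (conj_exp s) (- a) \<mu> b"
    have "(\<integral>\<^sup>+z. ennreal (\<phi> n z) * modf b z \<partial>lebesgue) \<le> (\<integral>\<^sup>+z. F z * modf b z \<partial>lebesgue)"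
      unfolding \<phi> by (intro nn_integral_mono mult_right_mono) (auto split: split_indicator)
    also have "\<dots> \<le> D" by (rule D[OF b])
    finally show "(\<integral>\<^sup>+z. ennreal (\<phi> n z) * modf b z \<partial>lebesgue) \<le> D" .
  qed (auto simp: \<phi>_def)
  have sum_le: "(\<Sum>ij\<in>S. c ij * Lr_norm r (\<lambda>z. F z * indicator (dyadic_rect k l) z * indicator (?sh ij) z) epowr s)
      \<le> (ennreal (2 powr (real_of_int (k + l) * \<mu>)) * D) epowr s" if "finite S" for S
  proof -
    have incX: "incseq (\<lambda>n. ennreal (\<phi> n z) * indicator (?sh ij) z)" for z ij
      using inc[of z] by (auto simp: incseq_def intro!: mult_right_mono)
    have "Lr_norm r (\<lambda>z. F z * indicator (dyadic_rect k l) z * indicator (?sh ij) z)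
        = (SUP n. Lr_norm r (\<lambda>z. ennreal (\<phi> n z) * indicator (?sh ij) z))" for ij
    proof -
      have "Lr_norm r (\<lambda>z. SUP n. ennreal (\<phi> n z) * indicator (?sh ij) z)
          = (SUP n. Lr_norm r (\<lambda>z. ennreal (\<phi> n z) * indicator (?sh ij) z))"
        using r by (intro Lr_norm_SUP incX) auto
      then show ?thesis by (simp add: sup flip: SUP_mult_right_ennreal)
    qed
    then have "c ij * Lr_norm r (\<lambda>z. F z * indicator (dyadic_rect k l) z * indicator (?sh ij) z) epowr s
        = (SUP n. c ij * Lr_norm r (\<lambda>z. ennreal (\<phi> n z) * indicator (?sh ij) z) epowr s)" for ij
      using s by (simp add: SUP_epowr SUP_mult_left_ennreal)
    moreover have "incseq (\<lambda>n. c ij * Lr_norm r (\<lambda>z. ennreal (\<phi> n z) * indicator (?sh ij) z) epowr s)" for ij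
      using incX[of _ ij] r s
      by (auto simp: incseq_def intro!: mult_left_mono epowr_mono Lr_norm_mono)
    ultimately have "(\<Sum>ij\<in>S. c ij * Lr_norm r (\<lambda>z. F z * indicator (dyadic_rect k l) z * indicator (?sh ij) z) epowr s)
      = (SUP n. \<Sum>ij\<in>S. c ij * Lr_norm r (\<lambda>z. ennreal (\<phi> n z) * indicator (?sh ij) z) epowr s)"
      by (simp add: ennreal_SUP_sum)
    also have "\<dots> \<le> (ennreal (2 powr (real_of_int (k + l) * \<mu>)) * D) epowr s"
      by (intro SUP_least part that)
    finally show ?thesis .
  qed
  have "(\<Sum>\<^sub>\<infinity>ij. c ij * Lr_norm r (\<lambda>z. F z * indicator (dyadic_rect k l) z * indicator (?sh ij) z) epowr s)
      \<le> (ennreal (2 powr (real_of_int (k + l) * \<mu>)) * D) epowr s"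
    unfolding nonneg_infsum_complete[OF zero_le] by (intro SUP_least sum_le) blast
  then show ?thesis
    using s by (simp add: herz_norm_eq_nn_integral nn_integral_count_space_eq_infsum c_def epowr_le_iff)
qed

lemma morrey_herz_norm_le_dual:
  fixes F :: "('n::finite, 'm::finite) prodsp \<Rightarrow> ennreal"
  assumes "F \<in> borel_measurable lebesgue" "1 < r" "1 < s"
    and "\<And>b. herz_block (conj_exp r) (conj_exp s) (- a) \<mu> b \<Longrightarrow> (\<integral>\<^sup>+z. F z * modf b z \<partial>lebesgue) \<le> D"
  shows "morrey_herz_norm r s a \<mu> F \<le> D"
  unfolding morrey_herz_norm_def
proof (intro SUP_least)
  fix k l :: int
  have "ennreal (2 powr (- real_of_int (k + l) * \<mu>)) * herz_norm r s a (\<lambda>z. F z * indicator (dyadic_rect k l) z)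
      \<le> ennreal (2 powr (- real_of_int (k + l) * \<mu>)) * (ennreal (2 powr (real_of_int (k + l) * \<mu>)) * D)"
    by (intro mult_left_mono herz_norm_le_dual assms) auto
  also have "\<dots> = D"
    using ennreal_powr_cancel[of "real_of_int (k + l) * \<mu>" "- real_of_int (k + l) * \<mu>"]
    by (simp only: mult.assoc[symmetric]) (simp add: algebra_simps)
  finally show "ennreal (2 powr (- real_of_int (k + l) * \<mu>)) * herz_norm r s a (\<lambda>z. F z * indicator (dyadic_rect k l) z) \<le> D" .
qed

subsection \<open>Extrapolation\<close>

text \<open>The term \<open>k = 0\<close> is already \<open>modf h\<close>: its denominator is one,
  whatever the operator norm, because a zeroth power in \<open>ennreal\<close> is one.\<close>

lemma le_rubio_de_francia: "modf h z \<le> rubio_de_francia r s a \<mu> h z"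
proof -
  let ?t = "\<lambda>k. (strong_maximal ^^ k) (modf h) z / (2 ^ k * strong_maximal_opnorm TYPE('a) TYPE('b) r s a \<mu> ^ k)"
  have "(\<Sum>k\<in>{0}. ?t k) \<le> (\<Sum>k. ?t k)" by (rule sum_le_suminf) auto
  then show ?thesis by (simp add: rubio_de_francia_def divide_ennreal_def)
qed

text \<open>\<open>F\<close> and \<open>G\<close> are arbitrary measurable extended functions, so
  single functions and infinite sums of powers are covered alike. Only blocks are tested, as they
  already determine the Morrey-Herz norm by duality.\<close>

lemma morrey_herz_norm_extrapolation:
  fixes F G :: "('n::finite, 'm::finite) prodsp \<Rightarrow> ennreal"
  assumes F: "F \<in> borel_measurable lebesgue" and G: "G \<in> borel_measurable lebesgue"
    and rs: "1 < r" "1 < s"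
    and le: "\<And>b. herz_block (conj_exp r) (conj_exp s) (- a) \<mu> b \<Longrightarrow>
      (\<integral>\<^sup>+z. F z * rubio_de_francia (conj_exp r) (conj_exp s) (- a) \<mu> b z \<partial>lebesgue)
        \<le> C * (\<integral>\<^sup>+z. G z * rubio_de_francia (conj_exp r) (conj_exp s) (- a) \<mu> b z \<partial>lebesgue)"
  shows "morrey_herz_norm r s a \<mu> F \<le> 2 * C * morrey_herz_norm r s a \<mu> G"
proof (rule morrey_herz_norm_le_dual[OF F rs])
  fix b :: "('n, 'm) prodsp \<Rightarrow> complex"
  let ?R = "rubio_de_francia (conj_exp r) (conj_exp s) (- a) \<mu> b"
  assume b: "herz_block (conj_exp r) (conj_exp s) (- a) \<mu> b"
  have "(\<integral>\<^sup>+z. F z * modf b z \<partial>lebesgue) \<le> (\<integral>\<^sup>+z. F z * ?R z \<partial>lebesgue)"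
    by (intro nn_integral_mono mult_left_mono le_rubio_de_francia) auto
  also have "\<dots> \<le> C * (\<integral>\<^sup>+z. G z * ?R z \<partial>lebesgue)" by (rule le[OF b])
  also have "\<dots> \<le> C * (2 * morrey_herz_norm r s a \<mu> G)"
    by (intro mult_left_mono nn_integral_mult_rubio_de_francia_le G rs b) auto
  finally show "(\<integral>\<^sup>+z. F z * modf b z \<partial>lebesgue) \<le> 2 * C * morrey_herz_norm r s a \<mu> G"
    by (simp add: mult_ac)
qed

section \<open>Passage from the exponents \<open>p\<close>, \<open>q\<close> to
  \<open>p / p0\<close>, \<open>q / p0\<close>\<close>

lemma epowr_mult_indicator: "x epowr a * indicator A z = (x * indicator A z) epowr a"
  by (simp split: split_indicator)

lemma Lr_norm_epowr:
  "0 < p0 \<Longrightarrow> 0 < p \<Longrightarrow> Lr_norm p (\<lambda>z. F z epowr (1 / p0)) = Lr_norm (p / p0) F epowr (1 / p0)"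
  by (simp add: Lr_norm_def epowr_epowr)

lemma herz_norm_epowr:
  assumes "0 < p0" "0 < p" "0 < q"
  shows "herz_norm p q \<alpha> (\<lambda>z. F z epowr (1 / p0)) = herz_norm (p / p0) (q / p0) (p0 * \<alpha>) F epowr (1 / p0)"
  using assms by (simp add: herz_norm_def epowr_mult_indicator Lr_norm_epowr epowr_epowr mult.assoc)

text \<open>Taking the root \<open>1 / p0\<close> commutes with suprema, products and cut-offs. The
  weights must be written as such roots too, which multiplies \<open>\<alpha>\<close> and
  \<open>lam\<close> by \<open>p0\<close>.\<close>

lemma morrey_herz_norm_epowr:
  assumes "0 < p0" "0 < p" "0 < q"
  shows "morrey_herz_norm p q \<alpha> lam (\<lambda>z. F z epowr (1 / p0))
    = morrey_herz_norm (p / p0) (q / p0) (p0 * \<alpha>) (p0 * lam) F epowr (1 / p0)"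
proof -
  have "2 powr (- real_of_int (k + l) * lam) = (2 powr (- real_of_int (k + l) * (p0 * lam))) powr (1 / p0)" for k l
    using assms by (simp add: powr_powr)
  then have w: "ennreal (2 powr (- real_of_int (k + l) * lam)) = ennreal (2 powr (- real_of_int (k + l) * (p0 * lam))) epowr (1 / p0)" for k l
    by (simp only: epowr_ennreal powr_ge_zero)
  have H: "herz_norm p q \<alpha> (\<lambda>z. F z epowr (1 / p0) * indicator (dyadic_rect k l) z)
      = herz_norm (p / p0) (q / p0) (p0 * \<alpha>) (\<lambda>z. F z * indicator (dyadic_rect k l) z) epowr (1 / p0)" for k l
    by (simp only: epowr_mult_indicator herz_norm_epowr[OF assms])
  have "0 < 1 / p0" using assms by simp
  then show ?thesis
    by (simp only: morrey_herz_norm_def H w SUP_epowr epowr_mult)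
qed

theorem theorem4p2:
  fixes \<alpha> p0 p q lam :: real
    and \<F> :: "((('n::finite, 'm::finite) prodsp \<Rightarrow> complex) \<times> (('n, 'm) prodsp \<Rightarrow> complex)) set"
  assumes "0 < p0" and "p0 < p" and "p0 < q"
    and "0 < lam" and "lam < min (\<alpha> + real CARD('n) / p) (\<alpha> + real CARD('m) / p)"
    and "max (- real CARD('n) / p) (- real CARD('m) / p) < \<alpha>"
    and "\<alpha> < min (real CARD('n) * (1 / p0 - 1 / p)) (real CARD('m) * (1 / p0 - 1 / p))"
    and "\<And>f g. (f, g) \<in> \<F> \<Longrightarrow> f \<in> borel_measurable lebesgue \<and> g \<in> borel_measurable lebesgue"
    and "\<exists>C :: real. C > 0 \<and>
      (\<forall>v \<in> rubio_de_francia (conj_exp (p / p0)) (conj_exp (q / p0)) (- p0 * \<alpha>) (p0 * lam) `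
             {h. block_herz_norm (conj_exp (p / p0)) (conj_exp (q / p0)) (- p0 * \<alpha>) (p0 * lam) h \<le> 1}.
        \<forall>(f, g) \<in> \<F>.
          (\<integral>\<^sup>+ x. (modf f x epowr p0) * v x \<partial>lebesgue)
            \<le> ennreal C * (\<integral>\<^sup>+ x. (modf g x epowr p0) * v x \<partial>lebesgue) \<and>
          ennreal C * (\<integral>\<^sup>+ x. (modf g x epowr p0) * v x \<partial>lebesgue) < \<infinity>)"
  shows "(\<exists>C' :: real. C' > 0 \<and>
           (\<forall>(f, g) \<in> \<F>.
              morrey_herz_norm p q \<alpha> lam (modf f) \<le> ennreal C' * morrey_herz_norm p q \<alpha> lam (modf g))) \<and>
         (\<exists>C'' :: real. C'' > 0 \<and>
           (\<forall>fs gs :: nat \<Rightarrow> ('n, 'm) prodsp \<Rightarrow> complex. (\<forall>i. (fs i, gs i) \<in> \<F>) \<longrightarrow>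
              morrey_herz_norm p q \<alpha> lam (\<lambda>x. (\<Sum>i. modf (fs i) x epowr p0) epowr (1 / p0))
                \<le> ennreal C'' *
                  morrey_herz_norm p q \<alpha> lam (\<lambda>x. (\<Sum>i. modf (gs i) x epowr p0) epowr (1 / p0))))"
proof -
  let ?r = "conj_exp (p / p0)" and ?s = "conj_exp (q / p0)"
  \<comment> \<open>The hypothesis has \<open>- p0 * \<alpha>\<close>, parsed as a product with
    \<open>- p0\<close>; it is rewritten to match \<open>- a\<close> with
    \<open>a = p0 * \<alpha>\<close> in the lemmas above.\<close>
  define v :: "(('n, 'm) prodsp \<Rightarrow> complex) \<Rightarrow> ('n, 'm) prodsp \<Rightarrow> ennreal"
    where "v = rubio_de_francia ?r ?s (- (p0 * \<alpha>)) (p0 * lam)"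
  obtain C where "0 < C" and C: "\<And>b f g. block_herz_norm ?r ?s (- (p0 * \<alpha>)) (p0 * lam) b \<le> 1 \<Longrightarrow> (f, g) \<in> \<F> \<Longrightarrow>
      (\<integral>\<^sup>+x. modf f x epowr p0 * v b x \<partial>lebesgue) \<le> ennreal C * (\<integral>\<^sup>+x. modf g x epowr p0 * v b x \<partial>lebesgue)"
    using assms(9) unfolding v_def mult_minus_left by blast
  have pq: "0 < p" "0 < q" "1 < p / p0" "1 < q / p0" using assms(1-3) by simp_all
  have meas: "(\<lambda>x. modf f x epowr p0) \<in> borel_measurable lebesgue" "(\<lambda>x. modf g x epowr p0) \<in> borel_measurable lebesgue"
    if "(f, g) \<in> \<F>" for f g
  proof -
    have [measurable]: "f \<in> borel_measurable lebesgue" "g \<in> borel_measurable lebesgue"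
      using assms(8)[OF that] by simp_all
    show "(\<lambda>x. modf f x epowr p0) \<in> borel_measurable lebesgue" "(\<lambda>x. modf g x epowr p0) \<in> borel_measurable lebesgue"
      unfolding modf_def by measurable
  qed
  \<comment> \<open>The constant \<open>2 * C\<close> for the exponents \<open>p / p0\<close>,
    \<open>q / p0\<close>, after taking the root \<open>1 / p0\<close>. It serves both
    conclusions.\<close>
  define C' where "C' = (2 * C) powr (1 / p0)"
  have "0 < C'" using \<open>0 < C\<close> by (simp add: C'_def)
  have key: "morrey_herz_norm p q \<alpha> lam (\<lambda>x. F x epowr (1 / p0))
      \<le> ennreal C' * morrey_herz_norm p q \<alpha> lam (\<lambda>x. G x epowr (1 / p0))"
    if FG: "F \<in> borel_measurable lebesgue" "G \<in> borel_measurable lebesgue"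
      and le: "\<And>b. herz_block ?r ?s (- (p0 * \<alpha>)) (p0 * lam) b \<Longrightarrow>
        (\<integral>\<^sup>+x. F x * v b x \<partial>lebesgue) \<le> ennreal C * (\<integral>\<^sup>+x. G x * v b x \<partial>lebesgue)"
    for F G :: "('n, 'm) prodsp \<Rightarrow> ennreal"
  proof -
    let ?N = "morrey_herz_norm (p / p0) (q / p0) (p0 * \<alpha>) (p0 * lam)"
    have "?N F \<le> 2 * ennreal C * ?N G"
      using morrey_herz_norm_extrapolation[OF FG pq(3,4)] le unfolding v_def by blast
    then have "?N F epowr (1 / p0) \<le> (2 * ennreal C * ?N G) epowr (1 / p0)"
      using assms(1) by (intro epowr_mono) auto
    also have "2 * ennreal C = ennreal (2 * C)" using \<open>0 < C\<close> by (simp add: ennreal_mult)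
    also have "(ennreal (2 * C) * ?N G) epowr (1 / p0) = ennreal C' * ?N G epowr (1 / p0)"
      using \<open>0 < C\<close> by (simp only: epowr_mult) (simp add: epowr_ennreal C'_def)
    finally show ?thesis
      by (simp only: morrey_herz_norm_epowr[OF assms(1) pq(1,2)])
  qed
  have single: "morrey_herz_norm p q \<alpha> lam (modf f) \<le> ennreal C' * morrey_herz_norm p q \<alpha> lam (modf g)"
    if fg: "(f, g) \<in> \<F>" for f g
    using key[OF meas[OF fg] C[OF herz_block_norm_le_1 fg]] assms(1) by simp
  have vector: "morrey_herz_norm p q \<alpha> lam (\<lambda>x. (\<Sum>i. modf (fs i) x epowr p0) epowr (1 / p0))
      \<le> ennreal C' * morrey_herz_norm p q \<alpha> lam (\<lambda>x. (\<Sum>i. modf (gs i) x epowr p0) epowr (1 / p0))"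
    if fg: "\<And>i. (fs i, gs i) \<in> \<F>" for fs gs :: "nat \<Rightarrow> ('n, 'm) prodsp \<Rightarrow> complex"
  proof (rule key)
    note [measurable] = meas[OF fg]
    show "(\<lambda>x. \<Sum>i. modf (fs i) x epowr p0) \<in> borel_measurable lebesgue"
      and "(\<lambda>x. \<Sum>i. modf (gs i) x epowr p0) \<in> borel_measurable lebesgue"
      by measurable
    fix b :: "('n, 'm) prodsp \<Rightarrow> complex"
    assume b: "herz_block ?r ?s (- (p0 * \<alpha>)) (p0 * lam) b"
    have [measurable]: "v b \<in> borel_measurable lebesgue"
      using b unfolding v_def herz_block_def by (intro measurable_rubio_de_francia) simp
    \<comment> \<open>Against a fixed weight the hypothesis is linear in the \<open>p0\<close>-th
      powers, so it can be summed over \<open>i\<close> with the same constant.\<close>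
    have "(\<integral>\<^sup>+x. (\<Sum>i. modf (fs i) x epowr p0) * v b x \<partial>lebesgue)
        = (\<Sum>i. \<integral>\<^sup>+x. modf (fs i) x epowr p0 * v b x \<partial>lebesgue)"
      by (simp add: nn_integral_suminf flip: ennreal_suminf_multc)
    also have "\<dots> \<le> (\<Sum>i. ennreal C * (\<integral>\<^sup>+x. modf (gs i) x epowr p0 * v b x \<partial>lebesgue))"
      by (intro suminf_le C herz_block_norm_le_1 b fg) auto
    also have "\<dots> = ennreal C * (\<integral>\<^sup>+x. (\<Sum>i. modf (gs i) x epowr p0) * v b x \<partial>lebesgue)"
      by (simp add: nn_integral_suminf flip: ennreal_suminf_multc)
    finally show "(\<integral>\<^sup>+x. (\<Sum>i. modf (fs i) x epowr p0) * v b x \<partial>lebesgue)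
        \<le> ennreal C * (\<integral>\<^sup>+x. (\<Sum>i. modf (gs i) x epowr p0) * v b x \<partial>lebesgue)" .
  qed
  show ?thesis
    using \<open>0 < C'\<close> single vector by blast
qed

end
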